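(* For any $(B^3,2n)$-tangle $B$ which is a braid (on $n$ strands), the Kauffman bracket ideal of $B$ is trivial: $I_B=\mathbb{Z}[A,A^{-1}]$.
   Context: A $(B^3,2n)$-tangle is a 1-manifold with $2n$ boundary points properly embedded in a ball $B^3\subset S^3$; an $n$-strand geometric braid in $D^2\times I\cong B^3$ is such a tangle. A closure of a $(B^3,2n)$-tangle $\mathcal T$ is a link in $S^3$ obtained by gluing to $\mathcal T$, along its boundary points, a 1-manifold with the same $2n$ boundary points properly embedded in $S^3-\mathrm{Int}(B^3)$. The Kauffman bracket $\langle D\rangle\in\mathbb{Z}[A,A^{-1}]$ is determined by $\langle\emptyset\rangle=1$, $\langle D'\sqcup\bigcirc\rangle=\delta\langle D'\rangle$ with $\delta=-A^2-A^{-2}$, and the usual skein relation; the reduced bracket of a non-empty link diagram is $\langle D\rangle'=\langle D\rangle/\delta$ (for a link, well defined up to units $\pm A^k$). $I_{\mathcal T}$ is the ideal of $\mathbb{Z}[A,A^{-1}]$ generated by the reduced Kauffman bracket polynomials of all closures of $\mathcal T$. *)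

theory Defs
  imports "HOL-Analysis.Analysis" "HOL-Library.Poly_Mapping"
begin

section \<open>The 3-sphere, tangles, braids and closures\<close>

text \<open>
  We work in the topological category with locally flat submanifolds, which is equivalent to the
  smooth and to the piecewise linear one in dimension three. Euclidean 3-space is
  \<^typ>\<open>complex \<times> real\<close>, so that the cylinder over the unit disc is a literal product, and it
  is regarded as a subset of the 3-sphere through the inverse of stereographic projection.
\<close>

type_synonym space3 = "complex \<times> real"
type_synonym space4 = "space3 \<times> real"

definition S3 :: "space4 set" where
  "S3 = sphere 0 1"

definition stereo :: "space3 \<Rightarrow> space4" where
  "stereo x = ((2 / ((norm x)\<^sup>2 + 1)) *\<^sub>R x, ((norm x)\<^sup>2 - 1) / ((norm x)\<^sup>2 + 1))"

definition cylinder :: "space3 set" where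
  "cylinder = cball 0 1 \<times> {0..1}"

definition ambient_isotopy :: "(real \<Rightarrow> space4 \<Rightarrow> space4) \<Rightarrow> bool" where
  "ambient_isotopy H \<longleftrightarrow>
     continuous_on ({0..1} \<times> S3) (\<lambda>(t, x). H t x) \<and>
     (\<forall>t\<in>{0..1}. \<exists>g. homeomorphism S3 S3 (H t) g) \<and>
     (\<forall>x\<in>S3. H 0 x = x)"

definition ambient_isotopic :: "space4 set \<Rightarrow> space4 set \<Rightarrow> bool" where
  "ambient_isotopic L L' \<longleftrightarrow> (\<exists>H. ambient_isotopy H \<and> H 1 ` L = L')"

text \<open>Tame closed balls; an arbitrary subset homeomorphic to a ball could be a wild one.\<close>

definition ball_in_S3 :: "space4 set \<Rightarrow> bool" where
  "ball_in_S3 B \<longleftrightarrow> (\<exists>h g. homeomorphism S3 S3 h g \<and> B = h ` stereo ` cylinder)"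

definition boundary_S3 :: "space4 set \<Rightarrow> space4 set" where
  "boundary_S3 B = top_of_set S3 frontier_of B"

definition exterior_S3 :: "space4 set \<Rightarrow> space4 set" where
  "exterior_S3 B = S3 - top_of_set S3 interior_of B"

text \<open>
  Compact (locally flat) 1-manifolds \<open>M\<close> properly embedded in a 3-manifold \<open>X\<close> with boundary.
  The local model is the closed upper half space with its vertical half axis. The target \<open>V\<close> of a
  chart may lie in the open half space, which covers the interior points of \<open>M\<close>; by invariance of
  domain the points of \<open>M\<close> sent to height 0 are exactly those on the boundary of \<open>X\<close>, so the
  boundary of \<open>M\<close> is the intersection of \<open>M\<close> with the boundary of \<open>X\<close>. Neither \<open>X\<close> nor \<open>M\<close>
  need be connected or nonempty, and \<open>M\<close> may have closed components.
\<close>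

definition properly_embedded_1_manifold :: "space4 set \<Rightarrow> space4 set \<Rightarrow> bool" where
  "properly_embedded_1_manifold X M \<longleftrightarrow>
     compact M \<and> M \<subseteq> X \<and>
     (\<forall>p\<in>M. \<exists>U (V :: space3 set) f g.
        p \<in> U \<and> openin (top_of_set X) U \<and> openin (top_of_set (UNIV \<times> {0..})) V \<and>
        homeomorphism U V f g \<and> f ` (U \<inter> M) = V \<inter> ({0} \<times> UNIV))"

text \<open>The pair \<open>(B, T)\<close> is a $(B^3,2n)$-tangle.\<close>

definition tangle :: "nat \<Rightarrow> space4 set \<Rightarrow> space4 set \<Rightarrow> bool" where
  "tangle n B T \<longleftrightarrow>
     ball_in_S3 B \<and> properly_embedded_1_manifold B T \<and>
     finite (T \<inter> boundary_S3 B) \<and> card (T \<inter> boundary_S3 B) = 2 * n"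

definition tangle_closure :: "space4 set \<Rightarrow> space4 set \<Rightarrow> space4 set \<Rightarrow> bool" where
  "tangle_closure B T L \<longleftrightarrow>
     (\<exists>T'. properly_embedded_1_manifold (exterior_S3 B) T' \<and>
           T' \<inter> boundary_S3 B = T \<inter> boundary_S3 B \<and> L = T \<union> T')"

text \<open>The \<open>n\<close> standard collinear points of the open unit disc.\<close>

definition braid_point :: "nat \<Rightarrow> nat \<Rightarrow> complex" where
  "braid_point n i = of_real (2 * (real i + 1) / (real n + 1) - 1)"

definition geometric_braid :: "nat \<Rightarrow> space3 set \<Rightarrow> bool" where
  "geometric_braid n K \<longleftrightarrow>
     (\<exists>\<gamma> :: nat \<Rightarrow> real \<Rightarrow> complex.
        (\<forall>i<n. continuous_on {0..1} (\<gamma> i) \<and> \<gamma> i ` {0..1} \<subseteq> ball 0 1 \<and>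
               \<gamma> i 0 = braid_point n i \<and> \<gamma> i 1 \<in> braid_point n ` {..<n}) \<and>
        (\<forall>t\<in>{0..1}. inj_on (\<lambda>i. \<gamma> i t) {..<n}) \<and>
        K = {(\<gamma> i t, t) | i t. i < n \<and> t \<in> {0..1}})"

text \<open>
  The identification of the cylinder with the ball \<open>B\<close> is realised by an ambient isotopy of the
  3-sphere; the identity is allowed, so geometric braids in the standard cylinder are included.
\<close>

definition braid_tangle :: "nat \<Rightarrow> space4 set \<Rightarrow> space4 set \<Rightarrow> bool" where
  "braid_tangle n B T \<longleftrightarrow>
     (\<exists>K H. geometric_braid n K \<and> ambient_isotopy H \<and>
            B = H 1 ` stereo ` cylinder \<and> T = H 1 ` stereo ` K)"


section \<open>Link diagrams\<close>

text \<open>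
  Links are projected along the imaginary direction. The pictures are drawn with the real axis to
  the right and the height upwards; for the standard orientation (real, imaginary, height) the
  viewer then sits at imaginary part \<open>-\<infinity>\<close>, so the over strand is the one with the smaller
  imaginary part.
\<close>

definition proj :: "space3 \<Rightarrow> complex" where
  "proj x = Complex (Re (fst x)) (snd x)"

text \<open>
  A crossing is recorded with a small disc around it in which the diagram consists of two
  diameters, of directions \<open>over_dir\<close> and \<open>under_dir\<close> (unit vectors). A direction is only relevant up
  to sign, and the signs are chosen so that \<open>under_dir\<close> is reached from \<open>over_dir\<close> by a
  counterclockwise rotation through an angle less than \<open>\<pi>\<close>.
\<close>

record crossing =
  centre :: complex
  radius :: real
  over_dir :: complex
  under_dir :: complex

definition disc :: "crossing \<Rightarrow> complex set" where
  "disc c = cball (centre c) (radius c)"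

definition chord :: "crossing \<Rightarrow> complex \<Rightarrow> complex \<Rightarrow> complex set" where
  "chord c u v = closed_segment (centre c + radius c *\<^sub>R u) (centre c + radius c *\<^sub>R v)"

definition regular_crossing :: "space3 set \<Rightarrow> crossing \<Rightarrow> bool" where
  "regular_crossing L c \<longleftrightarrow>
     radius c > 0 \<and> norm (over_dir c) = 1 \<and> norm (under_dir c) = 1 \<and>
     Im (cnj (over_dir c) * under_dir c) > 0 \<and>
     (\<exists>P Q. compact P \<and> compact Q \<and> L \<inter> proj -` disc c = P \<union> Q \<and>
        bij_betw proj P (chord c (over_dir c) (- over_dir c)) \<and>
        bij_betw proj Q (chord c (under_dir c) (- under_dir c)) \<and>
        (\<exists>p\<in>P. \<exists>q\<in>Q. proj p = centre c \<and> proj q = centre c \<and> Im (fst p) < Im (fst q)))"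

text \<open>
  A diagram is a plane set together with an enumeration of its crossings (in any order). It is a
  diagram of \<open>L\<close> if it is the image of \<open>L\<close> and the given crossings are its only multiple points.
\<close>

type_synonym diagram = "complex set \<times> crossing list"

definition diagram_of :: "space3 set \<Rightarrow> diagram \<Rightarrow> bool" where
  "diagram_of L = (\<lambda>(G, cs).
     G = proj ` L \<and> distinct cs \<and>
     pairwise (\<lambda>c d. disjnt (disc c) (disc d)) (set cs) \<and>
     (\<forall>c\<in>set cs. regular_crossing L c) \<and>
     inj_on proj {x \<in> L. proj x \<notin> centre ` set cs})"

definition link_diagram :: "space4 set \<Rightarrow> diagram \<Rightarrow> bool" where
  "link_diagram L D \<longleftrightarrow> (\<exists>L'. diagram_of L' D \<and> ambient_isotopic (stereo ` L') L)"


section \<open>The Kauffman bracket\<close>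

text \<open>
  Integer Laurent polynomials in one variable are the finitely supported functions
  \<^typ>\<open>int \<Rightarrow> int\<close> with the convolution product.
\<close>

type_synonym laurent = "int \<Rightarrow>\<^sub>0 int"

definition A_pow :: "int \<Rightarrow> laurent" where
  "A_pow k = Poly_Mapping.single k 1"

definition delta :: laurent where
  "delta = - A_pow 2 - A_pow (- 2)"

text \<open>
  The \<open>A\<close>-regions of a crossing are those swept out by the over strand when it is rotated
  counterclockwise, that is, the regions between \<open>over_dir\<close> and \<open>under_dir\<close> and between their
  negatives. The \<open>A\<close>-smoothing joins these two regions, the \<open>B\<close>-smoothing the other two.
\<close>

definition smooth_A :: "crossing \<Rightarrow> complex set \<Rightarrow> complex set" where
  "smooth_A c G = (G - disc c) \<union> chord c (over_dir c) (- under_dir c)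
                               \<union> chord c (- over_dir c) (under_dir c)"

definition smooth_B :: "crossing \<Rightarrow> complex set \<Rightarrow> complex set" where
  "smooth_B c G = (G - disc c) \<union> chord c (over_dir c) (under_dir c)
                               \<union> chord c (- over_dir c) (- under_dir c)"

text \<open>
  The skein relation is applied to the crossings one after the other. A diagram without crossings
  consists of disjoint simple closed curves, so the first two rules give a power of \<open>\<delta>\<close>, with
  value 1 on the empty diagram.
\<close>

primrec bracket_resolve :: "crossing list \<Rightarrow> complex set \<Rightarrow> laurent" where
  "bracket_resolve [] G = delta ^ card (components G)"
| "bracket_resolve (c # cs) G =
     A_pow 1 * bracket_resolve cs (smooth_A c G) + A_pow (- 1) * bracket_resolve cs (smooth_B c G)"

definition kauffman_bracket :: "diagram \<Rightarrow> laurent" where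
  "kauffman_bracket D = bracket_resolve (snd D) (fst D)"

text \<open>
  The quotient by \<open>\<delta>\<close>. It exists for every nonempty link diagram, and it is unique because Laurent
  polynomials form an integral domain.
\<close>

definition reduced_bracket :: "diagram \<Rightarrow> laurent" where
  "reduced_bracket D = (THE q. kauffman_bracket D = delta * q)"

text \<open>
  The reduced bracket of a link is only defined up to a unit, so all diagrams of all closures are
  used. Closures are empty only in the case of the empty tangle without boundary points, where the
  empty closure has no reduced bracket. The ideal generated by a set is its span in the ring viewed
  as a module over itself.
\<close>

lemma module_laurent: "module ((*) :: laurent \<Rightarrow> laurent \<Rightarrow> laurent)"
  by unfold_locales (simp_all add: algebra_simps)

definition kauffman_ideal :: "space4 set \<Rightarrow> space4 set \<Rightarrow> laurent set" where
  "kauffman_ideal B T =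
     module.span (*) {reduced_bracket D | D L. tangle_closure B T L \<and> L \<noteq> {} \<and> link_diagram L D}"

end

(*
  By isotopy extension, an ambient isotopy preserving the cylinder takes the trivial braid to any
  given one: over short time intervals the strands move so little that the points of a slice can be
  pushed along by adding a displacement that is a contraction, and identity plus contraction is a
  homeomorphism of the plane. So it suffices to close the trivial braid, and joining its parallel
  strands one after the other in the plane gives a diagram without crossings of the unknot, whose
  reduced bracket is 1. One or two vertical strands outside the cylinder are added first, so that
  there is a positive even number of strands to pair up by the arcs above and below.
*)

theory Submission
  imports Defs
begin

subsection \<open>Stereographic projection\<close>

text \<open>The braid itself never has to be drawn: a link diagram is required only of some link
  ambient isotopic to the closure, so one isotopy of the whole sphere carries a fixed planar curve
  to a closure of the given tangle. The work lies in continuity and tameness. The isotopy must be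
  continuous at infinity, hence displacements of bounded support; and every point of the closing
  arcs needs a chart of the exterior, up to the boundary where an arc meets the cylinder. Therefore
  the arcs are given by equations F(u, h) = 0 in a plane: F itself becomes a chart coordinate, and
  corners are harmless because charts are only continuous. All equations but one come from the graph
  of sin(pi u): stretching each zero to a vertical segment turns it into a chain through all
  strands.\<close>

definition north_pole :: space4 where
  "north_pole = (0, 1)"

definition stereo_inv :: "space4 \<Rightarrow> space3" where
  "stereo_inv q = (1 / (1 - snd q)) *\<^sub>R fst q"

lemma in_S3_iff: "q \<in> S3 \<longleftrightarrow> (norm (fst q))\<^sup>2 + (snd q)\<^sup>2 = 1"
  by (cases q) (simp add: S3_def norm_Pair)

lemma compact_S3: "compact S3"
  by (simp add: S3_def)

lemma north_pole_in_S3: "north_pole \<in> S3"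
  by (simp add: in_S3_iff north_pole_def)

lemma norm_sq_plus_one_pos: "(norm x)\<^sup>2 + 1 > 0"
  by (simp add: add_nonneg_pos)

lemma stereo_in_S3: "stereo x \<in> S3"
proof -
  define r where "r = (norm x)\<^sup>2"
  have r: "r + 1 > 0" "r \<ge> 0"
    using norm_sq_plus_one_pos[of x] by (auto simp: r_def)
  have "(norm (fst (stereo x)))\<^sup>2 = 4 * r / (r + 1)\<^sup>2"
    using r by (simp add: stereo_def power_mult_distrib power_divide r_def)
  moreover have "(snd (stereo x))\<^sup>2 = (r - 1)\<^sup>2 / (r + 1)\<^sup>2"
    by (simp add: stereo_def power_divide r_def)
  moreover have "4 * r / (r + 1)\<^sup>2 + (r - 1)\<^sup>2 / (r + 1)\<^sup>2 = 1"
  proof -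
    have "4 * r + (r - 1)\<^sup>2 = (r + 1)\<^sup>2"
      by (simp add: power2_eq_square algebra_simps)
    then show ?thesis
      using r by (simp flip: add_divide_distrib)
  qed
  ultimately show ?thesis
    by (simp add: in_S3_iff)
qed

lemma one_minus_snd_stereo: "1 - snd (stereo x) = 2 / ((norm x)\<^sup>2 + 1)"
  using norm_sq_plus_one_pos[of x] by (simp add: stereo_def field_simps)

lemma stereo_neq_north_pole: "stereo x \<noteq> north_pole"
proof
  assume "stereo x = north_pole"
  then have "2 / ((norm x)\<^sup>2 + 1) = 0"
    using one_minus_snd_stereo[of x] by (simp add: north_pole_def)
  then show False
    using norm_sq_plus_one_pos[of x] by simp
qed

lemma stereo_inv_stereo: "stereo_inv (stereo x) = x"
proof -
  have "fst (stereo x) = (2 / ((norm x)\<^sup>2 + 1)) *\<^sub>R x"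
    by (simp add: stereo_def)
  then show ?thesis
    using norm_sq_plus_one_pos[of x] unfolding stereo_inv_def one_minus_snd_stereo
    by (simp add: add_divide_distrib flip: distrib_right)
qed

lemma snd_less_one:
  assumes "q \<in> S3 - {north_pole}" shows "snd q < 1"
proof -
  have eq: "(norm (fst q))\<^sup>2 + (snd q)\<^sup>2 = 1"
    using assms by (simp add: in_S3_iff)
  then have "(snd q)\<^sup>2 \<le> 1\<^sup>2"
    using zero_le_power2[of "norm (fst q)"] unfolding one_power2 by linarith
  then have "snd q \<le> 1"
    by (rule power2_le_imp_le) simp
  moreover have "snd q \<noteq> 1"
    using eq assms by (cases q) (auto simp: north_pole_def)
  ultimately show ?thesis by simp
qed

lemma stereo_stereo_inv:
  assumes "q \<in> S3 - {north_pole}" shows "stereo (stereo_inv q) = q"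
proof -
  obtain v s where q: "q = (v, s)" by (cases q)
  have s: "s < 1" using snd_less_one[OF assms] q by simp
  have eq: "(norm v)\<^sup>2 = 1 - s\<^sup>2"
    using assms by (simp add: in_S3_iff q)
  have n: "(norm (stereo_inv q))\<^sup>2 = (1 + s) / (1 - s)"
  proof -
    have "(norm (stereo_inv q))\<^sup>2 = (1 - s\<^sup>2) / (1 - s)\<^sup>2"
      by (simp add: stereo_inv_def q power_divide eq)
    also have "\<dots> = (1 + s) / (1 - s)"
      using s by (simp add: divide_simps) (simp add: power2_eq_square algebra_simps)
    finally show ?thesis .
  qed
  have n1: "(norm (stereo_inv q))\<^sup>2 + 1 = 2 / (1 - s)"
    using s unfolding n by (simp add: field_simps)
  have n2: "(norm (stereo_inv q))\<^sup>2 - 1 = 2 * s / (1 - s)"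
    using s unfolding n by (simp add: field_simps)
  show ?thesis
    using s unfolding stereo_def n1 n2 by (simp add: stereo_inv_def q)
qed

lemma continuous_on_stereo: "continuous_on X stereo"
proof -
  have "(norm x)\<^sup>2 + 1 \<noteq> 0" for x :: space3
    using norm_sq_plus_one_pos[of x] by linarith
  then show ?thesis
    unfolding stereo_def by (intro continuous_intros) auto
qed

lemma range_stereo: "range stereo = S3 - {north_pole}"
proof
  show "range stereo \<subseteq> S3 - {north_pole}"
    by (simp add: image_subset_iff stereo_in_S3 stereo_neq_north_pole)
  show "S3 - {north_pole} \<subseteq> range stereo"
    using stereo_stereo_inv by (metis rangeI subsetI)
qed

lemma homeomorphism_stereo: "homeomorphism UNIV (S3 - {north_pole}) stereo stereo_inv"
proof (rule homeomorphismI)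
  show "continuous_on (S3 - {north_pole}) stereo_inv"
    unfolding stereo_inv_def using snd_less_one by (intro continuous_intros) force
qed (use continuous_on_stereo range_stereo stereo_inv_stereo stereo_stereo_inv in blast)+

lemma inj_stereo: "inj_on stereo X"
  by (metis inj_on_inverseI stereo_inv_stereo)

lemma open_image_stereo:
  assumes "open W" shows "openin (top_of_set S3) (stereo ` W)"
proof -
  have "openin (top_of_set (S3 - {north_pole})) (stereo ` W)"
    using homeomorphism_imp_open_map[OF homeomorphism_stereo, of W] assms by simp
  moreover have "openin (top_of_set S3) (S3 - {north_pole})"
    by (simp add: openin_delete)
  ultimately show ?thesis
    using openin_trans by blast
qed

section \<open>Boundary and exterior of balls in the 3-sphere\<close>

lemma homeomorphic_map_S3:
  assumes "homeomorphism S3 S3 h g" shows "homeomorphic_map (top_of_set S3) (top_of_set S3) h"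
  unfolding homeomorphic_map_maps homeomorphic_maps_def
  using assms by (intro exI[of _ g]) (auto simp: homeomorphism_def)

lemma boundary_S3_image:
  assumes "homeomorphism S3 S3 h g" "B \<subseteq> S3"
  shows "boundary_S3 (h ` B) = h ` boundary_S3 B"
  unfolding boundary_S3_def
  using homeomorphic_map_frontier_of[OF homeomorphic_map_S3[OF assms(1)]] assms(2) by simp

lemma exterior_S3_image:
  assumes "homeomorphism S3 S3 h g" "B \<subseteq> S3"
  shows "exterior_S3 (h ` B) = h ` exterior_S3 B"
proof -
  have i: "top_of_set S3 interior_of h ` B = h ` (top_of_set S3 interior_of B)"
    using homeomorphic_map_interior_of[OF homeomorphic_map_S3[OF assms(1)]] assms(2) by simp
  have sub: "top_of_set S3 interior_of B \<subseteq> S3"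
    using interior_of_subset[of "top_of_set S3" B] assms(2) by blast
  have "inj_on h S3" "h ` S3 = S3"
    using assms(1) unfolding homeomorphism_def by (auto intro: inj_on_inverseI)
  then show ?thesis
    unfolding exterior_S3_def i using inj_on_image_set_diff[of h S3 S3 "top_of_set S3 interior_of B"] sub
    by simp
qed

abbreviation open_cylinder :: "space3 set" where
  "open_cylinder \<equiv> ball 0 1 \<times> {0<..<1}"

lemma interior_cylinder: "interior cylinder = open_cylinder"
  by (simp add: cylinder_def interior_Times)

text \<open>\<open>stereo\<close> is a homeomorphism onto an open subset of \<open>S3\<close>, so
  interiors can be computed in Euclidean space.\<close>

lemma interior_of_stereo:
  "top_of_set S3 interior_of (stereo ` X) = stereo ` interior X"
proof
  show "stereo ` interior X \<subseteq> top_of_set S3 interior_of (stereo ` X)"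
    by (rule interior_of_maximal) (use interior_subset in \<open>auto intro!: open_image_stereo\<close>)
  let ?I = "top_of_set S3 interior_of (stereo ` X)"
  have sub: "?I \<subseteq> stereo ` X" by (rule interior_of_subset)
  have "openin (top_of_set S3) ?I" by simp
  then obtain O' where O': "open O'" "?I = S3 \<inter> O'"
    unfolding openin_open by blast
  have "open (stereo -` O')"
    using O'(1) continuous_on_stereo[of UNIV] by (simp add: continuous_on_open_vimage)
  moreover have "stereo -` O' \<subseteq> X"
  proof
    fix x assume "x \<in> stereo -` O'"
    then have "stereo x \<in> ?I" using O' stereo_in_S3 by auto
    then show "x \<in> X" using sub stereo_inv_stereo by (metis image_iff subsetD)
  qed
  ultimately have "stereo -` O' \<subseteq> interior X" by (simp add: interior_maximal)
  then show "?I \<subseteq> stereo ` interior X"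
    using sub O' by blast
qed

lemma exterior_S3_cylinder: "exterior_S3 (stereo ` cylinder) = S3 - stereo ` open_cylinder"
  unfolding exterior_S3_def interior_of_stereo interior_cylinder ..

lemma compact_cylinder: "compact cylinder"
  by (simp add: cylinder_def compact_Times)

lemma boundary_S3_cylinder: "boundary_S3 (stereo ` cylinder) = stereo ` (cylinder - open_cylinder)"
proof -
  have "closedin (top_of_set S3) (stereo ` cylinder)"
    using compact_continuous_image[OF continuous_on_stereo compact_cylinder] stereo_in_S3
    by (auto intro!: closed_subset compact_imp_closed)
  then have "top_of_set S3 closure_of (stereo ` cylinder) = stereo ` cylinder"
    by (simp add: closure_of_closedin)
  then show ?thesis
    unfolding boundary_S3_def frontier_of_def interior_of_stereo interior_cylinder
    by (simp add: image_set_diff[OF inj_stereo])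
qed

subsection \<open>Ambient isotopies\<close>

lemma ambient_isotopy_homeomorphism:
  assumes "ambient_isotopy H" obtains g where "homeomorphism S3 S3 (H 1) g"
  using assms unfolding ambient_isotopy_def by (metis atLeastAtMost_iff zero_le_one order_refl)

text \<open>Composing at each time, instead of running one isotopy after the other, gives the same
  end map without any gluing in time.\<close>

lemma ambient_isotopy_comp:
  assumes H: "ambient_isotopy H" and H': "ambient_isotopy H'"
  shows "ambient_isotopy (\<lambda>t. H t \<circ> H' t)"
  unfolding ambient_isotopy_def
proof (intro conjI ballI)
  have S: "H' t x \<in> S3" if "t \<in> {0..1}" "x \<in> S3" for t x
    using H' that unfolding ambient_isotopy_def homeomorphism_def by blast
  have c: "continuous_on ({0..1} \<times> S3) (\<lambda>(t, x). H t x)"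
    and c': "continuous_on ({0..1} \<times> S3) (\<lambda>p. H' (fst p) (snd p))"
    using H H' by (auto simp: ambient_isotopy_def case_prod_unfold)
  have "continuous_on ({0..1} \<times> S3) ((\<lambda>(t, x). H t x) \<circ> (\<lambda>p. (fst p, H' (fst p) (snd p))))"
    by (rule continuous_on_compose) 
      (use S in \<open>auto intro!: continuous_intros c' continuous_on_subset[OF c]\<close>)
  then show "continuous_on ({0..1} \<times> S3) (\<lambda>(t, x). (H t \<circ> H' t) x)"
    by (simp add: o_def case_prod_unfold)
  show "\<exists>g. homeomorphism S3 S3 (H t \<circ> H' t) g" if "t \<in> {0..1}" for t
    using H H' that homeomorphism_compose unfolding ambient_isotopy_def by metis
  show "(H 0 \<circ> H' 0) x = x" if "x \<in> S3" for x
    using H H' that by (auto simp: ambient_isotopy_def)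
qed

lemma ambient_isotopy_id: "ambient_isotopy (\<lambda>t x. x)"
  unfolding ambient_isotopy_def
  by (auto simp: case_prod_unfold intro!: continuous_intros homeomorphism_ident)

section \<open>Isotopies that add a contraction\<close>

text \<open>A solution of \<open>x + f x = y\<close> is a fixed point of the contraction x \<mapsto>
  y - f x. The fixed point theorem asks for a nonnegative constant, hence
  \<open>max k 0\<close>.\<close>

lemma bij_add_contraction:
  fixes f :: "'a::banach \<Rightarrow> 'a"
  assumes "k < 1" and "\<And>x y. norm (f x - f y) \<le> k * norm (x - y)"
  shows "bij (\<lambda>x. x + f x)"
proof -
  have lip: "norm (f x - f y) \<le> max k 0 * norm (x - y)" for x y
    using assms(2)[of x y] mult_right_mono[of k "max k 0" "norm (x - y)"] by simp
  have "\<exists>!x. y - f x = x" for y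
    by (rule banach_fix_type[of "max k 0"])
       (use assms(1) lip in \<open>auto simp: dist_norm norm_minus_commute\<close>)
  then show ?thesis
    unfolding bij_iff by (metis add_diff_cancel_right' diff_add_cancel)
qed

text \<open>The Lipschitz bound is asked only within planes of constant height, since a braid is
  merely continuous in the height.\<close>

locale horizontal_displacement =
  fixes u :: "space3 \<Rightarrow> complex" and k R :: real
  assumes continuous: "continuous_on UNIV u"
    and support: "\<And>x. norm x \<ge> R \<Longrightarrow> u x = 0"
    and contraction: "\<And>z z' h. norm (u (z, h) - u (z', h)) \<le> k * norm (z - z')"
    and less_one: "k < 1"
begin

definition shift :: "real \<Rightarrow> space3 \<Rightarrow> space3" where
  "shift s x = (fst x + s *\<^sub>R u x, snd x)"

definition isotopy :: "real \<Rightarrow> space4 \<Rightarrow> space4" where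
  "isotopy s q = (if q = north_pole then north_pole else stereo (shift s (stereo_inv q)))"

text \<open>Each horizontal plane is mapped to itself, and there the scaled displacement is still a
  contraction.\<close>

lemma bij_shift:
  assumes "s \<in> {0..1}" shows "bij (shift s)"
proof -
  have "bij (\<lambda>z. z + s *\<^sub>R u (z, h))" for h
  proof (rule bij_add_contraction[of "max k 0"])
    fix z z'
    have "norm (s *\<^sub>R u (z, h) - s *\<^sub>R u (z', h)) = s * norm (u (z, h) - u (z', h))"
      using assms by (simp flip: scaleR_diff_right)
    also have "\<dots> \<le> norm (u (z, h) - u (z', h))"
      using assms by (simp add: mult_left_le_one_le)
    also have "\<dots> \<le> max k 0 * norm (z - z')"
      using contraction[of z h z'] mult_right_mono[of k "max k 0" "norm (z - z')"] by simp
    finally show "norm (s *\<^sub>R u (z, h) - s *\<^sub>R u (z', h)) \<le> max k 0 * norm (z - z')" .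
  qed (use less_one in auto)
  then have ex: "\<exists>!z. z + s *\<^sub>R u (z, h) = w" for h w
    by (auto simp: bij_iff)
  show ?thesis
    unfolding bij_iff
  proof
    fix y :: space3
    have "shift s x = y \<longleftrightarrow> snd x = snd y \<and> fst x + s *\<^sub>R u (fst x, snd y) = fst y" for x
      by (metis fst_conv prod.collapse shift_def snd_conv)
    then show "\<exists>!x. shift s x = y"
      using ex[of "snd y" "fst y"] by (metis fst_conv prod.expand snd_conv)
  qed
qed

lemma isotopy_stereo: "isotopy s (stereo x) = stereo (shift s x)"
  by (simp add: isotopy_def stereo_neq_north_pole stereo_inv_stereo)

lemma ambient_isotopy: "ambient_isotopy isotopy"
  unfolding ambient_isotopy_def
proof (intro conjI ballI)
  let ?f = "\<lambda>(t, x). isotopy t x"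
  let ?S = "{0..1::real} \<times> (S3 - {north_pole})" and ?T = "{0..1::real} \<times> (S3 - stereo ` cball 0 R)"
  have "continuous_on ?S (\<lambda>p. stereo_inv (snd p))"
    by (rule continuous_on_compose2[OF homeomorphism_cont2[OF homeomorphism_stereo]])
      (auto intro!: continuous_intros)
  then have "continuous_on ?S (\<lambda>p. stereo (shift (fst p) (stereo_inv (snd p))))"
    unfolding shift_def
    by (intro continuous_on_compose2[OF continuous_on_stereo[of UNIV]]
        continuous_on_compose2[OF continuous] continuous_intros) auto
  then have S: "continuous_on ?S ?f"
  proof (rule continuous_on_eq)
    show "stereo (shift (fst p) (stereo_inv (snd p))) = ?f p" if "p \<in> ?S" for p
      using that unfolding isotopy_def case_prod_unfold mem_Times_iff by simp
  qed
  \<comment> \<open>The map is the identity on a neighbourhood of the pole; together with the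
    complement of the pole this is an open cover on which continuity can be checked.\<close>
  have far: "isotopy t q = q" if "q \<in> S3 - stereo ` cball 0 R" for t q
  proof (cases "q = north_pole")
    case False
    then have q: "q = stereo (stereo_inv q)"
      using that stereo_stereo_inv by auto
    then have "norm (stereo_inv q) > R"
      using that by (metis DiffE image_eqI mem_cball_0 not_le)
    then have "u (stereo_inv q) = 0"
      by (simp add: support)
    then have "shift t (stereo_inv q) = stereo_inv q"
      by (simp add: shift_def)
    then show ?thesis
      using q isotopy_stereo by metis
  qed (simp add: isotopy_def)
  have "continuous_on ?T snd"
    by (intro continuous_intros)
  then have T: "continuous_on ?T ?f"
  proof (rule continuous_on_eq)
    show "snd p = ?f p" if "p \<in> ?T" for p
      using that far[of "snd p" "fst p"] unfolding case_prod_unfold mem_Times_iff by simp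
  qed
  have un: "{0..1} \<times> S3 = ?S \<union> ?T"
    using stereo_neq_north_pole by blast
  have c: "closed (stereo ` cball 0 R)"
    by (intro compact_imp_closed compact_continuous_image continuous_on_stereo compact_cball)
  have "?S = ({0..1} \<times> S3) \<inter> (UNIV \<times> - {north_pole})"
    "?T = ({0..1} \<times> S3) \<inter> (UNIV \<times> - (stereo ` cball 0 R))"
    by auto
  then have "openin (top_of_set ({0..1} \<times> S3)) ?S" "openin (top_of_set ({0..1} \<times> S3)) ?T"
    using c by (metis open_Compl open_Times open_UNIV closed_singleton openin_open_Int)+
  then show "continuous_on ({0..1} \<times> S3) ?f"
    unfolding un by (intro continuous_on_Un_local_open) (use S T in \<open>auto simp: Un_commute\<close>)
  show "isotopy 0 x = x" if "x \<in> S3" for x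
    using that by (auto simp: isotopy_def shift_def stereo_stereo_inv)
  fix t :: real assume t: "t \<in> {0..1}"
  have "continuous_on S3 (\<lambda>x. ?f (t, x))"
    by (rule continuous_on_compose2[OF \<open>continuous_on ({0..1} \<times> S3) ?f\<close>])
      (use t in \<open>auto intro!: continuous_intros\<close>)
  then have 1: "continuous_on S3 (isotopy t)" by simp
  have S3_eq: "S3 = insert north_pole (range stereo)"
    using range_stereo north_pole_in_S3 by blast
  have n: "isotopy t north_pole = north_pole"
    by (simp add: isotopy_def)
  have "isotopy t ` range stereo = stereo ` range (shift t)"
    by (simp only: image_image isotopy_stereo)
  then have r: "isotopy t ` range stereo = range stereo"
    using bij_is_surj[OF bij_shift[OF t]] by simp
  then have 2: "isotopy t ` S3 = S3"
    unfolding S3_eq using n by simp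
  have "inj_on (isotopy t) (range stereo)"
  proof (rule inj_onI, elim rangeE)
    fix p q x y assume "isotopy t p = isotopy t q" and p: "p = stereo x" and q: "q = stereo y"
    then have "shift t x = shift t y"
      by (metis isotopy_stereo stereo_inv_stereo)
    then show "p = q"
      using bij_is_inj[OF bij_shift[OF t]] p q by (simp add: inj_eq)
  qed
  moreover have "range stereo - {north_pole} = range stereo"
    using range_stereo by blast
  ultimately have "inj_on (isotopy t) S3"
    unfolding S3_eq inj_on_insert using n r range_stereo by (metis Diff_iff singletonI)
  then show "\<exists>g. homeomorphism S3 S3 (isotopy t) g"
    using homeomorphism_compact[OF compact_S3 1 2] by metis
qed

lemma shift_cylinder:
  assumes "\<And>z h. norm z \<ge> 1 \<Longrightarrow> u (z, h) = 0"
  shows "shift 1 ` cylinder = cylinder"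
proof -
  have b: "bij (shift 1)" by (rule bij_shift) simp
  have fix_: "shift 1 x = x" if "norm (fst x) > 1" for x
    using assms[of "fst x" "snd x"] that by (simp add: shift_def)
  have snd: "snd (shift 1 x) = snd x" for x
    by (simp add: shift_def)
  have "shift 1 x \<in> cylinder \<longleftrightarrow> x \<in> cylinder" for x
  proof -
    \<comment> \<open>Points beyond the unit disc are fixed, so by injectivity no other point is
      sent there.\<close>
    have "norm (fst (shift 1 x)) \<le> 1 \<longleftrightarrow> norm (fst x) \<le> 1"
      using fix_[of x] fix_[of "shift 1 x"] b by (metis bij_is_inj injD not_le)
    then show ?thesis
      using snd[of x] by (simp add: cylinder_def mem_Times_iff)
  qed
  then have "shift 1 -` cylinder = cylinder"
    unfolding set_eq_iff vimage_eq by blast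
  then show ?thesis
    using surj_image_vimage_eq[OF bij_is_surj[OF b]] by metis
qed

end

subsection \<open>Straightening a braid\<close>

text \<open>The radial bump makes \<open>z + bump r c z *\<^sub>R d\<close> push \<open>c\<close> to \<open>c + d\<close> while fixing everything
  at distance at least \<open>r\<close> from \<open>c\<close>.\<close>

definition bump :: "real \<Rightarrow> complex \<Rightarrow> complex \<Rightarrow> real" where
  "bump r c z = max 0 (1 - norm (z - c) / r)"

lemma bump_eq_0: "r > 0 \<Longrightarrow> norm (z - c) \<ge> r \<Longrightarrow> bump r c z = 0"
  by (simp add: bump_def field_simps)

lemma bump_centre: "bump r c c = 1"
  by (simp add: bump_def)

lemma bump_lipschitz:
  assumes "r > 0" shows "\<bar>bump r c z - bump r c z'\<bar> \<le> norm (z - z') / r"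
proof -
  have "\<bar>bump r c z - bump r c z'\<bar> \<le> \<bar>norm (z' - c) / r - norm (z - c) / r\<bar>"
    by (auto simp: bump_def)
  also have "\<dots> = \<bar>norm (z' - c) - norm (z - c)\<bar> / r"
    using assms by (simp flip: diff_divide_distrib)
  also have "\<dots> \<le> norm ((z' - c) - (z - c)) / r"
    using assms norm_triangle_ineq3[of "z' - c" "z - c"] by (intro divide_right_mono) auto
  also have "\<dots> = norm (z - z') / r"
    by (simp add: norm_minus_commute)
  finally show ?thesis .
qed

definition strands :: "nat \<Rightarrow> (nat \<Rightarrow> real \<Rightarrow> complex) \<Rightarrow> space3 set" where
  "strands n \<gamma> = {(\<gamma> i t, t) | i t. i < n \<and> t \<in> {0..1}}"

lemma strands_cong:
  assumes "\<And>i t. i < n \<Longrightarrow> t \<in> {0..1} \<Longrightarrow> \<gamma> i t = \<gamma>' i t"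
  shows "strands n \<gamma> = strands n \<gamma>'"
  unfolding strands_def using assms by (intro Collect_cong) metis

text \<open>\<open>r\<close> will be the radius of the bumps: they vanish outside the unit disc, so
  the cylinder is preserved, and at all other points of the same slice, so each point feels only its
  own bump. The bumps may still overlap.\<close>

locale moving_points =
  fixes n :: nat and \<gamma> :: "nat \<Rightarrow> real \<Rightarrow> complex" and r :: real
  assumes cont: "\<And>i. i < n \<Longrightarrow> continuous_on {0..1} (\<gamma> i)"
    and r_pos: "r > 0"
    and inside: "\<And>i t. i < n \<Longrightarrow> t \<in> {0..1} \<Longrightarrow> norm (\<gamma> i t) + r \<le> 1"
    and apart: "\<And>i j t. i < n \<Longrightarrow> j < n \<Longrightarrow> i \<noteq> j \<Longrightarrow> t \<in> {0..1} \<Longrightarrow> norm (\<gamma> i t - \<gamma> j t) \<ge> r"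
begin

text \<open>\<open>\<lambda>i t. \<gamma> i (min t \<tau>)\<close> follows the braid up to height
  \<open>\<tau>\<close> and is vertical above. The displacement is zero below \<open>\<tau>\<close>,
  follows the strands up to \<open>\<tau>'\<close>, and then stays constant to the top of the
  cylinder.\<close>

lemma advance:
  assumes \<tau>: "0 \<le> \<tau>" "\<tau> \<le> \<tau>'" "\<tau>' \<le> 1"
    and small: "\<And>i t. i < n \<Longrightarrow> t \<in> {\<tau>..\<tau>'} \<Longrightarrow> norm (\<gamma> i t - \<gamma> i \<tau>) < r / (real n + 1)"
  obtains H where "ambient_isotopy H" "H 1 ` stereo ` cylinder = stereo ` cylinder"
    "H 1 ` stereo ` strands n (\<lambda>i t. \<gamma> i (min t \<tau>)) = stereo ` strands n (\<lambda>i t. \<gamma> i (min t \<tau>'))"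
proof -
  define cl where "cl h = max \<tau> (min \<tau>' h)" for h
  \<comment> \<open>The first factor is 1 up to height 1 and 0 from height 2 on; the second is 0
    below height 0. This bounds the support.\<close>
  define d where "d i h = max 0 (min 1 (2 - h)) *\<^sub>R (\<gamma> i (cl h) - \<gamma> i \<tau>)" for i h
  define u :: "space3 \<Rightarrow> complex" where
    "u x = (\<Sum>i<n. bump r (\<gamma> i \<tau>) (fst x) *\<^sub>R d i (snd x))" for x
  have cl: "cl h \<in> {\<tau>..\<tau>'}" "cl h \<in> {0..1}" for h
    using \<tau> by (auto simp: cl_def)
  have d_le: "norm (d i h) \<le> r / (real n + 1)" if "i < n" for i h
  proof -
    have "norm (d i h) \<le> 1 * norm (\<gamma> i (cl h) - \<gamma> i \<tau>)"
      unfolding d_def norm_scaleR by (rule mult_right_mono) auto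
    then show ?thesis
      using small[OF that cl(1)[of h]] by linarith
  qed
  have u_outside: "u (z, h) = 0" if "norm z \<ge> 1" for z h
  proof -
    have "bump r (\<gamma> i \<tau>) z = 0" if "i < n" for i
      using \<open>norm z \<ge> 1\<close> inside[OF that, of \<tau>] \<tau> norm_triangle_ineq2[of z "\<gamma> i \<tau>"]
      by (intro bump_eq_0 r_pos) auto
    then show ?thesis
      by (simp add: u_def)
  qed
  \<comment> \<open>Each bump has Lipschitz constant \<open>1 / r\<close> and each displacement has
    norm at most \<open>r / (real n + 1)\<close>; overlapping bumps add up to \<open>n\<close> such
    terms. A point of norm at least 4 over the unit disc has height above 2 or below 0.\<close>
  interpret horizontal_displacement u "real n / (real n + 1)" 4
  proof
    have c: "continuous_on UNIV (d i)" if "i < n" for i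
    proof -
      have "continuous_on UNIV (\<lambda>h. \<gamma> i (cl h))"
        by (rule continuous_on_compose2[OF cont[OF that]])
          (use cl in \<open>auto simp: cl_def intro!: continuous_intros\<close>)
      then show ?thesis
        unfolding d_def by (intro continuous_intros)
    qed
    show "continuous_on UNIV u"
      unfolding u_def bump_def
      by (intro continuous_intros continuous_on_compose2[OF c]) (use r_pos in auto)
    show "u x = 0" if "norm x \<ge> 4" for x
    proof (cases "norm (fst x) \<ge> 1")
      case True
      then show ?thesis using u_outside[of "fst x" "snd x"] by simp
    next
      case False
      moreover have "norm x \<le> norm (fst x) + norm (snd x)"
        using norm_Pair_le[of "fst x" "snd x"] by simp
      ultimately have "snd x \<ge> 2 \<or> snd x \<le> 0"
        using that by auto
      then have "d i (snd x) = 0" for i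
        using \<tau> by (auto simp: d_def cl_def)
      then show ?thesis by (simp add: u_def)
    qed
    show "norm (u (z, h) - u (z', h)) \<le> real n / (real n + 1) * norm (z - z')" for z z' h
    proof -
      have "norm (u (z, h) - u (z', h))
          = norm (\<Sum>i<n. (bump r (\<gamma> i \<tau>) z - bump r (\<gamma> i \<tau>) z') *\<^sub>R d i h)"
        by (simp add: u_def sum_subtractf scaleR_diff_left)
      also have "\<dots> \<le> (\<Sum>i<n. norm (z - z') / (real n + 1))"
      proof (rule sum_norm_le)
        fix i assume i: "i \<in> {..<n}"
        have "norm ((bump r (\<gamma> i \<tau>) z - bump r (\<gamma> i \<tau>) z') *\<^sub>R d i h)
            \<le> norm (z - z') / r * (r / (real n + 1))"
          unfolding norm_scaleR using bump_lipschitz[OF r_pos] d_le i r_pos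
          by (intro mult_mono) auto
        then show "norm ((bump r (\<gamma> i \<tau>) z - bump r (\<gamma> i \<tau>) z') *\<^sub>R d i h)
            \<le> norm (z - z') / (real n + 1)"
          using r_pos by simp
      qed
      also have "\<dots> = real n / (real n + 1) * norm (z - z')"
        by simp
      finally show ?thesis .
    qed
  qed simp
  have push: "shift 1 (\<gamma> i (min t \<tau>), t) = (\<gamma> i (min t \<tau>'), t)" if i: "i < n" and t: "t \<in> {0..1}" for i t
  proof (cases "t \<le> \<tau>")
    case True
    then have "cl t = \<tau>" using \<tau> by (simp add: cl_def)
    then have "u (z, t) = 0" for z by (simp add: u_def d_def)
    then show ?thesis using True \<tau> by (simp add: shift_def)
  next
    case False
    have "bump r (\<gamma> j \<tau>) (\<gamma> i \<tau>) = (if j = i then 1 else 0)" if "j < n" for j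
      using apart[OF i that, of \<tau>] \<tau> by (auto simp: bump_centre intro!: bump_eq_0 r_pos)
    then have "u (\<gamma> i \<tau>, t) = (\<Sum>j<n. if j = i then d j t else 0)"
      unfolding u_def by (intro sum.cong) auto
    also have "\<dots> = d i t"
      using i by simp
    also have "\<dots> = \<gamma> i (min t \<tau>') - \<gamma> i \<tau>"
      using False t \<tau> by (simp add: d_def cl_def min.commute max_def)
    finally show ?thesis
      using False by (simp add: shift_def)
  qed
  have "shift 1 ` strands n (\<lambda>i t. \<gamma> i (min t \<tau>)) = strands n (\<lambda>i t. \<gamma> i (min t \<tau>'))"
  proof
    show "shift 1 ` strands n (\<lambda>i t. \<gamma> i (min t \<tau>)) \<subseteq> strands n (\<lambda>i t. \<gamma> i (min t \<tau>'))"
      using push by (fastforce simp: strands_def)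
    show "strands n (\<lambda>i t. \<gamma> i (min t \<tau>')) \<subseteq> shift 1 ` strands n (\<lambda>i t. \<gamma> i (min t \<tau>))"
    proof
      fix x assume "x \<in> strands n (\<lambda>i t. \<gamma> i (min t \<tau>'))"
      then obtain i t where "i < n" "t \<in> {0..1}" "x = (\<gamma> i (min t \<tau>'), t)"
        by (auto simp: strands_def)
      then show "x \<in> shift 1 ` strands n (\<lambda>i t. \<gamma> i (min t \<tau>))"
        using push[of i t] by (intro image_eqI[of _ _ "(\<gamma> i (min t \<tau>), t)"]) (auto simp: strands_def)
    qed
  qed
  moreover have "isotopy 1 ` stereo ` X = stereo ` shift 1 ` X" for X
    by (simp only: image_image isotopy_stereo)
  ultimately show ?thesis
    using that[OF ambient_isotopy] shift_cylinder[OF u_outside] by metis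
qed

text \<open>Uniform continuity of finitely many strands gives a common step \<open>1 / M\<close>
  short enough for \<open>advance\<close>; the resulting isotopies are composed.\<close>

lemma straighten:
  obtains H where "ambient_isotopy H" "H 1 ` stereo ` cylinder = stereo ` cylinder"
    "H 1 ` stereo ` strands n (\<lambda>i t. \<gamma> i 0) = stereo ` strands n \<gamma>"
proof -
  define \<epsilon> where "\<epsilon> = r / (real n + 1)"
  have \<epsilon>: "\<epsilon> > 0" using r_pos by (simp add: \<epsilon>_def)
  have "\<exists>\<delta>>0. \<forall>t\<in>{0..1}. \<forall>t'\<in>{0..1}. dist t' t < \<delta> \<longrightarrow> dist (\<gamma> i t') (\<gamma> i t) < \<epsilon>" if "i < n" for i
    using compact_uniformly_continuous[OF cont[OF that]] \<epsilon> by (auto simp: uniformly_continuous_on_def)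
  then obtain \<delta> where \<delta>: "\<And>i. i < n \<Longrightarrow> \<delta> i > 0"
    "\<And>i t t'. i < n \<Longrightarrow> t \<in> {0..1} \<Longrightarrow> t' \<in> {0..1} \<Longrightarrow> dist t' t < \<delta> i \<Longrightarrow> dist (\<gamma> i t') (\<gamma> i t) < \<epsilon>"
    by metis
  \<comment> \<open>The 1 keeps the minimum defined when there are no strands.\<close>
  define \<delta>0 where "\<delta>0 = Min (insert 1 (\<delta> ` {..<n}))"
  have \<delta>0: "\<delta>0 > 0" "\<And>i. i < n \<Longrightarrow> \<delta>0 \<le> \<delta> i"
    using \<delta>(1) by (auto simp: \<delta>0_def)
  obtain m where m: "inverse (real (Suc m)) < \<delta>0"
    using reals_Archimedean[OF \<delta>0(1)] by auto
  define M where "M = real (Suc m)"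
  have M: "M > 0" "1 / M < \<delta>0"
    using m by (auto simp: M_def divide_inverse)
  have "\<exists>H. ambient_isotopy H \<and> H 1 ` stereo ` cylinder = stereo ` cylinder \<and>
      H 1 ` stereo ` strands n (\<lambda>i t. \<gamma> i 0) = stereo ` strands n (\<lambda>i t. \<gamma> i (min t (real k / M)))"
    if "k \<le> Suc m" for k
    using that
  proof (induction k)
    case 0
    have "strands n (\<lambda>i t. \<gamma> i (min t (real 0 / M))) = strands n (\<lambda>i t. \<gamma> i 0)"
      by (rule strands_cong) simp
    then show ?case
      using ambient_isotopy_id by (intro exI[of _ "\<lambda>t x. x"]) simp
  next
    case (Suc k)
    then obtain H where H: "ambient_isotopy H" "H 1 ` stereo ` cylinder = stereo ` cylinder"
      "H 1 ` stereo ` strands n (\<lambda>i t. \<gamma> i 0) = stereo ` strands n (\<lambda>i t. \<gamma> i (min t (real k / M)))"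
      by auto
    have step: "0 \<le> real k / M" "real k / M \<le> real (Suc k) / M" "real (Suc k) / M \<le> 1"
      using M(1) Suc.prems by (auto simp: divide_right_mono) (simp add: M_def)
    have "norm (\<gamma> i t - \<gamma> i (real k / M)) < r / (real n + 1)"
      if i: "i < n" and t: "t \<in> {real k / M..real (Suc k) / M}" for i t
    proof -
      have "t - real k / M \<le> 1 / M"
        using t by (simp add: add_divide_distrib)
      then have "dist t (real k / M) < \<delta> i"
        using t M(2) \<delta>0(2)[OF i] by (auto simp: dist_real_def)
      then show ?thesis
        using \<delta>(2)[OF i, of "real k / M" t] t step by (auto simp: dist_norm \<epsilon>_def)
    qed
    then obtain H' where H': "ambient_isotopy H'" "H' 1 ` stereo ` cylinder = stereo ` cylinder"
      "H' 1 ` stereo ` strands n (\<lambda>i t. \<gamma> i (min t (real k / M)))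
        = stereo ` strands n (\<lambda>i t. \<gamma> i (min t (real (Suc k) / M)))"
      using advance[OF step] by metis
    show ?case
    proof (intro exI[of _ "\<lambda>t. H' t \<circ> H t"] conjI)
      show "ambient_isotopy (\<lambda>t. H' t \<circ> H t)"
        by (rule ambient_isotopy_comp[OF H'(1) H(1)])
    qed (simp_all only: image_comp[symmetric] H H')
  qed
  from this[of "Suc m"] obtain H where H: "ambient_isotopy H"
    "H 1 ` stereo ` cylinder = stereo ` cylinder"
    "H 1 ` stereo ` strands n (\<lambda>i t. \<gamma> i 0) = stereo ` strands n (\<lambda>i t. \<gamma> i (min t (real (Suc m) / M)))"
    by auto
  have "real (Suc m) / M = 1"
    using M by (simp add: M_def)
  then have "strands n (\<lambda>i t. \<gamma> i (min t (real (Suc m) / M))) = strands n \<gamma>"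
    by (intro strands_cong) (simp add: min_def)
  then show ?thesis
    using that H by metis
qed

end

section \<open>Clearance between the strands of a braid\<close>

lemma continuous_pos_lower_bound:
  fixes f :: "real \<Rightarrow> real"
  assumes "continuous_on {0..1} f" "\<And>t. t \<in> {0..1} \<Longrightarrow> f t > 0"
  obtains e where "e > 0" "\<And>t. t \<in> {0..1} \<Longrightarrow> f t \<ge> e"
proof -
  obtain t where "t \<in> {0..1}" "\<forall>s\<in>{0..1}. f t \<le> f s"
    using continuous_attains_inf[OF _ _ assms(1)] by auto
  then show ?thesis
    using that[of "f t"] assms(2) by auto
qed

definition trivial_braid :: "nat \<Rightarrow> space3 set" where
  "trivial_braid n = strands n (\<lambda>i t. braid_point n i)"

text \<open>By compactness each strand keeps a positive distance from the wall, and each two strands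
  from each other; the least of these finitely many bounds (and 1) serves as
  \<open>r\<close>.\<close>

lemma geometric_braid_isotopic_trivial:
  assumes "geometric_braid n K"
  obtains H where "ambient_isotopy H" "H 1 ` stereo ` cylinder = stereo ` cylinder"
    "H 1 ` stereo ` trivial_braid n = stereo ` K"
proof -
  obtain \<gamma> :: "nat \<Rightarrow> real \<Rightarrow> complex" where
    \<gamma>: "\<And>i. i < n \<Longrightarrow> continuous_on {0..1} (\<gamma> i)" "\<And>i t. i < n \<Longrightarrow> t \<in> {0..1} \<Longrightarrow> norm (\<gamma> i t) < 1"
      "\<And>i. i < n \<Longrightarrow> \<gamma> i 0 = braid_point n i"
      "\<And>t. t \<in> {0..1} \<Longrightarrow> inj_on (\<lambda>i. \<gamma> i t) {..<n}" and K: "K = strands n \<gamma>"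
    using assms unfolding geometric_braid_def strands_def by (fastforce simp: image_subset_iff)
  have "\<exists>e>0. \<forall>t\<in>{0..1}. 1 - norm (\<gamma> i t) \<ge> e" if "i < n" for i
    by (rule continuous_pos_lower_bound[of "\<lambda>t. 1 - norm (\<gamma> i t)"])
      (use that \<gamma> in \<open>auto intro!: continuous_intros\<close>)
  then obtain e where e: "\<And>i. i < n \<Longrightarrow> e i > 0" 
    "\<And>i t. i < n \<Longrightarrow> t \<in> {0..1} \<Longrightarrow> 1 - norm (\<gamma> i t) \<ge> e i"
    by metis
  have "\<exists>e>0. \<forall>t\<in>{0..1}. norm (\<gamma> i t - \<gamma> j t) \<ge> e" if "i < n" "j < n" "i \<noteq> j" for i j
  proof (rule continuous_pos_lower_bound[of "\<lambda>t. norm (\<gamma> i t - \<gamma> j t)"])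
    show "0 < norm (\<gamma> i t - \<gamma> j t)" if "t \<in> {0..1}" for t
      using \<gamma>(4)[OF that] \<open>i < n\<close> \<open>j < n\<close> \<open>i \<noteq> j\<close> by (auto simp: inj_on_def)
  qed (use that \<gamma> in \<open>auto intro!: continuous_intros\<close>)
  then obtain f where f: "\<And>i j. i < n \<Longrightarrow> j < n \<Longrightarrow> i \<noteq> j \<Longrightarrow> f i j > 0" 
    "\<And>i j t. i < n \<Longrightarrow> j < n \<Longrightarrow> i \<noteq> j \<Longrightarrow> t \<in> {0..1} \<Longrightarrow> norm (\<gamma> i t - \<gamma> j t) \<ge> f i j"
    by metis
  define A where "A = insert 1 (e ` {..<n} \<union> (\<lambda>(i, j). f i j) ` {(i, j). i < n \<and> j < n \<and> i \<noteq> j})"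
  have "finite {(i, j). i < n \<and> j < n \<and> i \<noteq> j}"
    by (rule finite_subset[of _ "{..<n} \<times> {..<n}"]) auto
  then have A: "finite A" "A \<noteq> {}" "\<And>a. a \<in> A \<Longrightarrow> a > 0"
    using e(1) f(1) by (auto simp: A_def)
  interpret moving_points n \<gamma> "Min A"
  proof
    show "Min A > 0" using A by simp
    show "norm (\<gamma> i t) + Min A \<le> 1" if "i < n" "t \<in> {0..1}" for i t
      using e(2)[OF that] Min_le[OF A(1), of "e i"] that(1) by (auto simp: A_def)
    show "norm (\<gamma> i t - \<gamma> j t) \<ge> Min A" if "i < n" "j < n" "i \<noteq> j" "t \<in> {0..1}" for i j t
    proof -
      have "f i j \<in> A" using that by (auto simp: A_def)
      then show ?thesis using f(2)[OF that] Min_le[OF A(1)] by fastforce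
    qed
  qed (use \<gamma> in auto)
  have "strands n (\<lambda>i t. \<gamma> i 0) = trivial_braid n"
    unfolding trivial_braid_def by (rule strands_cong) (simp add: \<gamma>(3))
  then show ?thesis
    using straighten that K by metis
qed

subsection \<open>Properly embedded 1-manifolds from injective charts\<close>

text \<open>Charts are precomposed with the inverse homeomorphism. This moves the closing arcs from
  the standard cylinder to the given ball.\<close>

lemma properly_embedded_image:
  assumes h: "homeomorphism S3 S3 h g" and X: "X \<subseteq> S3" and M: "properly_embedded_1_manifold X M"
  shows "properly_embedded_1_manifold (h ` X) (h ` M)"
  unfolding properly_embedded_1_manifold_def
proof (intro conjI ballI)
  have MX: "compact M" "M \<subseteq> X"
    using M unfolding properly_embedded_1_manifold_def by blast+
  have hX: "homeomorphism X (h ` X) h g"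
    by (rule homeomorphism_of_subsets[OF h X]) auto
  show "compact (h ` M)"
    using MX X by (meson compact_continuous_image continuous_on_subset h homeomorphism_cont1)
  show "h ` M \<subseteq> h ` X"
    using MX by blast
  fix q assume "q \<in> h ` M"
  then obtain p where p: "p \<in> M" "q = h p" by blast
  then obtain U and V :: "space3 set" and f k where UV: "p \<in> U" "openin (top_of_set X) U"
    "openin (top_of_set (UNIV \<times> {0..})) V" "homeomorphism U V f k"
    "f ` (U \<inter> M) = V \<inter> ({0} \<times> UNIV)"
    using M unfolding properly_embedded_1_manifold_def by metis
  have UX: "U \<subseteq> X"
    using UV(2) by (rule openin_imp_subset)
  have hU: "homeomorphism (h ` U) U g h"
    by (rule homeomorphism_symD, rule homeomorphism_of_subsets[OF hX UX]) auto
  have "inj_on h X"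
    by (rule inj_on_inverseI) (rule homeomorphism_apply1[OF hX])
  then have "h ` U \<inter> h ` M = h ` (U \<inter> M)"
    using UX MX(2) by (simp only: inj_on_image_Int)
  moreover have "g ` h ` (U \<inter> M) = U \<inter> M"
    using homeomorphism_apply1[OF hX] UX by force
  ultimately have "(f \<circ> g) ` (h ` U \<inter> h ` M) = V \<inter> ({0} \<times> UNIV)"
    using UV(5) by (simp only: image_comp[symmetric])
  moreover have "openin (top_of_set (h ` X)) (h ` U)"
    by (rule homeomorphism_imp_open_map[OF hX UV(2)])
  moreover have "homeomorphism (h ` U) V (f \<circ> g) (h \<circ> k)"
    by (rule homeomorphism_compose[OF hU UV(4)])
  ultimately show "\<exists>U (V :: space3 set) f g. q \<in> U \<and> openin (top_of_set (h ` X)) U \<and>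
      openin (top_of_set (UNIV \<times> {0..})) V \<and> homeomorphism U V f g \<and>
      f ` (U \<inter> h ` M) = V \<inter> ({0} \<times> UNIV)"
    using UV(1,3) p(2) by blast
qed

text \<open>Both kinds of charts are restrictions of an injective continuous map on an open subset of
  3-space, whose last coordinate is negative exactly inside the cylinder; invariance of domain then
  supplies the homeomorphism.\<close>

definition chart_at :: "space3 set \<Rightarrow> space3 \<Rightarrow> bool" where
  "chart_at C p \<longleftrightarrow> (\<exists>W (f :: space3 \<Rightarrow> space3). open W \<and> p \<in> W \<and> continuous_on W f \<and> inj_on f W \<and>
     (\<forall>x\<in>W. x \<in> open_cylinder \<longleftrightarrow> snd (f x) < 0) \<and>
     (\<forall>x\<in>W. snd (f x) \<ge> 0 \<longrightarrow> (x \<in> C \<longleftrightarrow> fst (f x) = 0)))"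

lemma properly_embedded_of_charts:
  assumes "compact C" and out: "C \<inter> open_cylinder = {}" and charts: "\<And>p. p \<in> C \<Longrightarrow> chart_at C p"
  shows "properly_embedded_1_manifold (S3 - stereo ` open_cylinder) (stereo ` C)"
  unfolding properly_embedded_1_manifold_def
proof (intro conjI ballI)
  show "compact (stereo ` C)"
    by (intro compact_continuous_image continuous_on_stereo assms)
  show "stereo ` C \<subseteq> S3 - stereo ` open_cylinder"
  proof (rule image_subsetI)
    fix x assume "x \<in> C"
    then have "x \<notin> open_cylinder" using out by blast
    then show "stereo x \<in> S3 - stereo ` open_cylinder"
      by (simp only: DiffI stereo_in_S3 inj_image_mem_iff[OF inj_stereo[of UNIV]] not_False_eq_True)
  qed
  fix q assume "q \<in> stereo ` C"
  then obtain p where p: "p \<in> C" "q = stereo p" by blast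
  obtain W and f :: "space3 \<Rightarrow> space3" where W: "open W" "p \<in> W" "continuous_on W f" "inj_on f W"
    and neg: "\<And>x. x \<in> W \<Longrightarrow> x \<in> open_cylinder \<longleftrightarrow> snd (f x) < 0"
    and C: "\<And>x. x \<in> W \<Longrightarrow> snd (f x) \<ge> 0 \<Longrightarrow> x \<in> C \<longleftrightarrow> fst (f x) = 0"
    using charts[OF p(1)] unfolding chart_at_def by metis
  define W' where "W' = W - open_cylinder"
  have W'W: "W' \<subseteq> W" by (auto simp: W'_def)
  obtain g where g: "homeomorphism W (f ` W) f g"
    using invariance_of_domain_homeomorphism[OF W(1,3) _ W(4)] by auto
  \<comment> \<open>The sign condition makes \<open>W'\<close> the part of \<open>W\<close> over the
    closed half space, so its image is relatively open there by invariance of domain.\<close>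
  have fW': "f ` W' = f ` W \<inter> (UNIV \<times> {0..})"
  proof
    show "f ` W' \<subseteq> f ` W \<inter> (UNIV \<times> {0..})"
      using neg by (force simp: W'_def mem_Times_iff)
    show "f ` W \<inter> (UNIV \<times> {0..}) \<subseteq> f ` W'"
    proof
      fix y assume "y \<in> f ` W \<inter> (UNIV \<times> {0..})"
      then obtain x where x: "x \<in> W" "y = f x" "snd (f x) \<ge> 0"
        by (auto simp: mem_Times_iff)
      then have "x \<in> W'"
        using neg[OF x(1)] unfolding W'_def by (simp only: DiffI not_less[symmetric] not_False_eq_True)
      then show "y \<in> f ` W'"
        using x(2) by blast
    qed
  qed
  have 1: "homeomorphism W' (f ` W') f g"
    by (rule homeomorphism_of_subsets[OF g W'W]) auto
  have 2: "homeomorphism (stereo ` W') W' stereo_inv stereo"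
    by (rule homeomorphism_symD, rule homeomorphism_of_subsets[OF homeomorphism_stereo subset_UNIV subset_refl refl])
  have hom: "homeomorphism (stereo ` W') (f ` W') (f \<circ> stereo_inv) (stereo \<circ> g)"
    by (rule homeomorphism_compose[OF 2 1])
  obtain O' where O': "open O'" "stereo ` W = S3 \<inter> O'"
    using open_image_stereo[OF W(1)] unfolding openin_open by blast
  have "stereo ` W' = (S3 \<inter> O') - stereo ` open_cylinder"
    unfolding W'_def image_set_diff[OF inj_stereo] O'(2) ..
  also have "\<dots> = (S3 - stereo ` open_cylinder) \<inter> O'"
    by (metis Int_Diff Int_commute)
  finally have U: "openin (top_of_set (S3 - stereo ` open_cylinder)) (stereo ` W')"
    using O'(1) by (simp only: openin_open_Int)
  have V: "openin (top_of_set (UNIV \<times> {0..})) (f ` W')"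
    using invariance_of_domain[OF W(3,1,4)] unfolding fW' openin_open by blast
  have "stereo ` W' \<inter> stereo ` C = stereo ` (W' \<inter> C)"
    by (rule image_Int[OF inj_stereo, symmetric])
  moreover have "stereo_inv ` stereo ` X = X" for X
    by (simp add: image_image stereo_inv_stereo)
  moreover have "f ` (W' \<inter> C) = f ` W' \<inter> ({0} \<times> UNIV)"
  proof -
    have "x \<in> C \<longleftrightarrow> f x \<in> {0} \<times> UNIV" if "x \<in> W'" for x
    proof -
      have "x \<in> W" "\<not> snd (f x) < 0"
        using that neg[of x] unfolding W'_def by blast+
      then show ?thesis
        using C[of x] by (simp add: mem_Times_iff)
    qed
    moreover have "f ` (A \<inter> C) = f ` A \<inter> D" if "\<And>x. x \<in> A \<Longrightarrow> x \<in> C \<longleftrightarrow> f x \<in> D" for A D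
      using that by blast
    ultimately show ?thesis by simp
  qed
  ultimately have eq: "(f \<circ> stereo_inv) ` (stereo ` W' \<inter> stereo ` C) = f ` W' \<inter> ({0} \<times> UNIV)"
    by (simp only: image_comp[symmetric])
  have "q \<in> stereo ` W'"
    unfolding p(2) W'_def using p(1) W(2) out by (intro imageI) blast
  then show "\<exists>U (V :: space3 set) f g. q \<in> U \<and>
      openin (top_of_set (S3 - stereo ` open_cylinder)) U \<and>
      openin (top_of_set (UNIV \<times> {0..})) V \<and> homeomorphism U V f g \<and>
      f ` (U \<inter> stereo ` C) = V \<inter> ({0} \<times> UNIV)"
    using U V hom eq by blast
qed

subsection \<open>A planar unknot meeting the cylinder in the trivial braid\<close>

text \<open>In the coordinate \<open>coord n\<close> on the real axis the \<open>i\<close>-th braid point is \<open>i\<close>, and the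
  axis leaves the unit disc at \<open>n - 1 / 2\<close>, so that \<open>n\<close> and \<open>n + 1\<close> lie outside.\<close>

definition coord :: "nat \<Rightarrow> real \<Rightarrow> real" where
  "coord n x = min ((x + 1) * (real n + 1) / 2 - 1) (((x + 1) * (real n + 1) / 2 + real n - 2) / 2)"

text \<open>With s = (x + 1)(n + 1) / 2, the affine coordinate s - 1 is i at the \<open>i\<close>-th
  braid point but n at the edge x = 1, which would put strand \<open>n\<close> on the wall of the
  cylinder. \<open>coord\<close> halves the slope beyond the value n - 1, which moves the edge to n
  - 1/2; the maximum here undoes this.\<close>

definition coord_inv :: "nat \<Rightarrow> real \<Rightarrow> real" where
  "coord_inv n u = 2 * (max u (2 * u - real n + 1) + 1) / (real n + 1) - 1"

text \<open>The least odd number that is at least \<open>n\<close>: counting starts at 0, so an odd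
  last index means an even number of strands.\<close>

definition last_strand :: "nat \<Rightarrow> nat" where
  "last_strand n = 2 * (n div 2) + 1"

text \<open>\<open>sin (pi * u) = squash h\<close> is the sine graph cut open along the axis, with a
  unit vertical segment inserted at every zero: positive half-waves become arcs above the cylinder,
  negative ones arcs below.\<close>

definition squash :: "real \<Rightarrow> real" where
  "squash h = max (h - 1) 0 + min h 0"

text \<open>The vertical segments over \<open>0, \<dots>, last_strand n\<close> are joined alternately above height 1
  and below height 0 by arcs of the sine curve, and the two outermost ones below all of these by a
  V-shaped arc.\<close>

definition on_curve :: "nat \<Rightarrow> real \<Rightarrow> real \<Rightarrow> bool" where
  "on_curve n u h \<longleftrightarrow> 0 \<le> u \<and> u \<le> real (last_strand n) \<and>
     (sin (pi * u) = squash h \<or> h = - 2 * min u (real (last_strand n) - u))"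

definition unknot :: "nat \<Rightarrow> space3 set" where
  "unknot n = {x. Im (fst x) = 0 \<and> on_curve n (coord n (Re (fst x))) (snd x)}"

section \<open>The coordinate on the real axis, and the sine near integers\<close>

lemma coord_coord_inv: "coord n (coord_inv n u) = u"
proof -
  have "(coord_inv n u + 1) * (real n + 1) / 2 = max u (2 * u - real n + 1) + 1"
    by (simp add: coord_inv_def)
  then show ?thesis
    unfolding coord_def by (auto simp: max_def min_def field_simps)
qed

lemma coord_inv_coord: "coord_inv n (coord n x) = x"
proof -
  define s where "s = (x + 1) * (real n + 1) / 2"
  have "max (coord n x) (2 * coord n x - real n + 1) + 1 = s"
    unfolding coord_def s_def[symmetric] by (auto simp: max_def min_def field_simps)
  then show ?thesis
    unfolding coord_inv_def by (simp add: s_def field_simps)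
qed

lemma coord_eq_iff: "coord n x = coord n y \<longleftrightarrow> x = y"
  by (metis coord_inv_coord)

lemma continuous_on_coord [continuous_intros]:
  "continuous_on S f \<Longrightarrow> continuous_on S (\<lambda>x. coord n (f x))"
  unfolding coord_def by (intro continuous_intros) auto

lemma continuous_on_squash [continuous_intros]:
  "continuous_on S f \<Longrightarrow> continuous_on S (\<lambda>x. squash (f x))"
  unfolding squash_def by (intro continuous_intros) auto

lemma braid_point_eq: "braid_point n i = complex_of_real (2 * (real i + 1) / (real n + 1) - 1)"
  by (simp add: braid_point_def)

lemma coord_braid_point:
  assumes "i < n" shows "coord n (Re (braid_point n i)) = real i"
proof -
  have "real i \<le> real n - 1" using assms by linarith
  then have "coord_inv n (real i) = Re (braid_point n i)"
    unfolding coord_inv_def braid_point_eq by simp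
  then show ?thesis
    using coord_coord_inv[of n "real i"] by simp
qed

lemma norm_braid_point_less:
  assumes "i < n" shows "norm (braid_point n i) < 1"
proof -
  have "real i + 1 < real n + 1" "0 < real i + 1"
    using assms by auto
  then have "2 * (real i + 1) / (real n + 1) < 2" "2 * (real i + 1) / (real n + 1) > 0"
    by (simp_all add: field_simps)
  then show ?thesis
    unfolding braid_point_eq norm_of_real by (simp add: abs_less_iff)
qed

lemma coord_le_iff: "coord n x \<le> real n - 1 / 2 \<longleftrightarrow> x \<le> 1"
proof -
  define s where "s = (x + 1) * (real n + 1) / 2"
  have "s \<le> real n + 1 \<longleftrightarrow> x \<le> 1"
  proof -
    have "s \<le> real n + 1 \<longleftrightarrow> (x + 1) * (real n + 1) \<le> 2 * (real n + 1)"
      unfolding s_def by (simp only: pos_divide_le_eq[OF zero_less_numeral] mult.commute[of _ 2])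
    also have "\<dots> \<longleftrightarrow> x + 1 \<le> 2"
      by (rule mult_le_cancel_right_pos) simp
    finally show ?thesis by simp
  qed
  then show ?thesis
    unfolding coord_def s_def[symmetric] by (auto simp: min_def split: if_splits)
qed

lemma le_last_strand: "n \<le> last_strand n"
  unfolding last_strand_def by linarith

lemma last_strand_pos: "real (last_strand n) \<ge> 1"
  by (simp add: last_strand_def)

text \<open>The last index is odd, so the reflection exchanging the outermost strands preserves the
  sine. This lets the last strand be treated as the first.\<close>

lemma sin_pi_reflect: "sin (pi * (real (last_strand n) - u)) = sin (pi * u)"
proof -
  have "cos (pi * real (last_strand n)) = - 1"
    unfolding cos_npi2 by (simp add: last_strand_def)
  moreover have "sin (pi * real (last_strand n)) = 0"
    by (rule sin_npi2)
  ultimately show ?thesis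
    by (simp add: right_diff_distrib sin_diff)
qed

lemma on_curve_reflect: "on_curve n (real (last_strand n) - u) h \<longleftrightarrow> on_curve n u h"
  unfolding on_curve_def sin_pi_reflect by (auto simp: min.commute)

lemma sin_pi_eq_0_iff:
  assumes "u \<ge> 0" shows "sin (pi * u) = 0 \<longleftrightarrow> (\<exists>j::nat. u = real j)"
proof
  assume "sin (pi * u) = 0"
  then obtain i :: int where "pi * u = of_int i * pi"
    unfolding sin_zero_iff_int2 by blast
  then have "u = of_int i" by simp
  then have "u = real (nat i)" using assms by simp
  then show "\<exists>j::nat. u = real j" by blast
qed auto

text \<open>Up to the sign \<open>cos (pi * real j)\<close> this is the sine on [-pi/2, pi/2]. Near
  a strand, sin(pi u) can therefore replace u as a coordinate.\<close>

lemma sin_pi_inj: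
  assumes "\<bar>u - real j\<bar> \<le> 1 / 2" "\<bar>v - real j\<bar> \<le> 1 / 2" "sin (pi * u) = sin (pi * v)"
  shows "u = v"
proof -
  have s: "sin (pi * w) = cos (pi * real j) * sin (pi * (w - real j))" for w
    using sin_add[of "pi * (w - real j)" "pi * real j"] by (simp add: algebra_simps)
  have "cos (pi * real j) \<noteq> 0" by simp
  then have "sin (pi * (u - real j)) = sin (pi * (v - real j))"
    using assms(3) unfolding s[of u] s[of v] by simp
  moreover have "- (pi / 2) \<le> pi * w" "pi * w \<le> pi / 2" if "\<bar>w\<bar> \<le> 1 / 2" for w
    using that mult_left_mono[of w "1/2" pi] mult_left_mono[of "-1/2" w pi] by (simp_all add: abs_le_iff)
  note this[OF assms(1)] this[OF assms(2)]
  ultimately have "pi * (u - real j) = pi * (v - real j)"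
    using sin_inj_pi by blast
  then show ?thesis by simp
qed

lemma sin_pi_nonneg: "0 \<le> u \<Longrightarrow> u \<le> 1 \<Longrightarrow> sin (pi * u) \<ge> 0"
  by (rule sin_ge_zero) (auto simp: mult_left_le)

lemma squash_neg: "h < 0 \<Longrightarrow> squash h = h" and squash_mid: "0 \<le> h \<Longrightarrow> h \<le> 1 \<Longrightarrow> squash h = 0"
  and squash_gt: "h > 1 \<Longrightarrow> squash h = h - 1" and squash_nonneg: "h \<ge> 0 \<Longrightarrow> squash h = max (h - 1) 0"
  by (auto simp: squash_def)

section \<open>Local equations of the curve\<close>

lemma on_curve_mid:
  assumes "on_curve n u h" "0 \<le> h" "h \<le> 1"
  obtains j where "u = real j" "j \<le> last_strand n"
proof -
  have u: "0 \<le> u" "u \<le> last_strand n" using assms by (auto simp: on_curve_def)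
  have "sin (pi * u) = 0"
  proof (cases "sin (pi * u) = squash h")
    case True
    then show ?thesis using assms squash_mid by simp
  next
    case False
    then have "h = - 2 * min u (last_strand n - u)" using assms by (simp add: on_curve_def)
    then have "u = 0 \<or> u = last_strand n" using assms(2) u by (auto simp: min_def split: if_splits)
    then show ?thesis by auto
  qed
  then show ?thesis
    using that u sin_pi_eq_0_iff[of u] by auto
qed

text \<open>Below height 0 only the V-shaped arc u = -h/2 is near strand 0, because u \<ge> 0 on the
  curve. Written with sines it merges with the segment and the arc above; the right-hand side is
  nonnegative and so also encodes u \<ge> 0.\<close>

lemma on_curve_near_first:
  assumes "\<bar>u\<bar> < 1 / 2" "- 1 < h"
  shows "on_curve n u h \<longleftrightarrow> sin (pi * u) = max (h - 1) 0 + sin (pi * (max (- h) 0 / 2))"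
proof -
  have m: "min u (last_strand n - u) = u" "u \<le> last_strand n"
    using assms last_strand_pos[of n] by auto
  have oc: "on_curve n u h \<longleftrightarrow> 0 \<le> u \<and> (sin (pi * u) = squash h \<or> h = - 2 * u)"
    unfolding on_curve_def using m by simp
  have pos: "sin (pi * u) \<ge> 0 \<longleftrightarrow> u \<ge> 0"
  proof
    assume *: "sin (pi * u) \<ge> 0"
    show "u \<ge> 0"
    proof (rule ccontr)
      assume "\<not> u \<ge> 0"
      then have "sin (pi * (- u)) > 0"
        using assms mult_strict_left_mono[of "- u" 1 pi] by (intro sin_gt_zero mult_pos_pos) auto
      then show False using * by simp
    qed
  qed (use assms sin_pi_nonneg in auto)
  show ?thesis
  proof (cases "h \<ge> 0")
    case True
    then have "h = - 2 * u \<and> 0 \<le> u \<Longrightarrow> u = 0 \<and> h = 0" by linarith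
    then show ?thesis
      using True pos unfolding oc by (auto simp: squash_nonneg)
  next
    case False
    then have "sin (pi * u) = sin (pi * (- h / 2)) \<longleftrightarrow> u = - h / 2"
      using sin_pi_inj[of u 0 "- h / 2"] assms by auto
    then show ?thesis
      using False pos unfolding oc by (auto simp: squash_neg max_def)
  qed
qed

text \<open>One equation covers the segment and the bends at both its ends. At an inner strand the
  V-shaped arc is out of reach, lying below height -1 there.\<close>

lemma on_curve_near_strand:
  assumes "j \<le> last_strand n"
  obtains c where "continuous_on UNIV c"
    "\<And>u h. \<bar>u - real j\<bar> < 1 / 2 \<Longrightarrow> - 1 < h \<Longrightarrow> on_curve n u h \<longleftrightarrow> sin (pi * u) = c h"
proof -
  let ?c = "\<lambda>h. max (h - 1) 0 + sin (pi * (max (- h) 0 / 2))"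
  have c: "continuous_on UNIV ?c"
    by (intro continuous_intros) auto
  consider "j = 0" | "j = last_strand n" | "0 < j" "j < last_strand n"
    using assms by linarith
  then show ?thesis
  proof cases
    case 1
    then show ?thesis
      using that[OF c] on_curve_near_first by simp
  next
    case 2
    show ?thesis
    proof (rule that[OF c])
      fix u h :: real assume "\<bar>u - real j\<bar> < 1 / 2" "- 1 < h"
      then show "on_curve n u h \<longleftrightarrow> sin (pi * u) = ?c h"
        using on_curve_near_first[of "real (last_strand n) - u" h n] 2
        by (simp add: sin_pi_reflect on_curve_reflect abs_minus_commute)
    qed
  next
    case 3
    then have j: "real j \<ge> 1" "real j \<le> real (last_strand n) - 1" by linarith+
    show ?thesis
    proof (rule that)
      show "continuous_on UNIV squash"
        using continuous_on_squash[OF continuous_on_id] by simp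
      fix u h :: real assume "\<bar>u - real j\<bar> < 1 / 2" "- 1 < h"
      then show "on_curve n u h \<longleftrightarrow> sin (pi * u) = squash h"
      proof -
        have "u > 1 / 2" "u < real (last_strand n) - 1 / 2"
          using j \<open>\<bar>u - real j\<bar> < 1 / 2\<close> by (simp_all only: abs_less_iff) linarith+
        then show ?thesis
          unfolding on_curve_def using \<open>- 1 < h\<close> by (auto simp: min_def)
      qed
    qed
  qed
qed

section \<open>Charts along the closing arcs\<close>

text \<open>The curve is planar, so the imaginary part is kept as a chart coordinate and a plane
  problem remains: \<open>F\<close> is a local equation of the curve, and \<open>T\<close> completes
  it to coordinates and detects the cylinder by its sign.\<close>

lemma chart_at_unknot:
  fixes F T :: "real \<Rightarrow> real \<Rightarrow> real"
  assumes W: "open W" "p \<in> W" 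
    and cont: "continuous_on UNIV (\<lambda>x. F (fst x) (snd x))" "continuous_on UNIV (\<lambda>x. T (fst x) (snd x))"
    and inj: "\<And>x y. x \<in> W \<Longrightarrow> y \<in> W \<Longrightarrow> 
        F (coord n (Re (fst x))) (snd x) = F (coord n (Re (fst y))) (snd y) \<Longrightarrow>
        T (coord n (Re (fst x))) (snd x) = T (coord n (Re (fst y))) (snd y) \<Longrightarrow>
        coord n (Re (fst x)) = coord n (Re (fst y)) \<and> snd x = snd y"
    and T: "\<And>x. x \<in> W \<Longrightarrow> x \<in> open_cylinder \<longleftrightarrow> T (coord n (Re (fst x))) (snd x) < 0"
    and F: "\<And>x. x \<in> W \<Longrightarrow> on_curve n (coord n (Re (fst x))) (snd x) \<longleftrightarrow> F (coord n (Re (fst x))) (snd x) = 0"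
  shows "chart_at (unknot n - open_cylinder) p"
  unfolding chart_at_def
proof (intro exI conjI ballI impI)
  let ?u = "\<lambda>x. coord n (Re (fst x))"
  let ?f = "\<lambda>x. (Complex (F (?u x) (snd x)) (Im (fst x)), T (?u x) (snd x))"
  show "open W" "p \<in> W" by fact+
  have "continuous_on W (\<lambda>x. F (?u x) (snd x))" "continuous_on W (\<lambda>x. T (?u x) (snd x))"
    using continuous_on_compose2[OF cont(1), of W "\<lambda>x. (?u x, snd x)"]
      continuous_on_compose2[OF cont(2), of W "\<lambda>x. (?u x, snd x)"]
    by (simp_all add: continuous_intros)
  then show "continuous_on W ?f"
    by (intro continuous_intros)
  show "inj_on ?f W"
  proof (rule inj_onI)
    fix x y assume xy: "x \<in> W" "y \<in> W" "?f x = ?f y"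
    then have "?u x = ?u y \<and> snd x = snd y" "Im (fst x) = Im (fst y)"
      using inj by simp_all
    then show "x = y"
      by (simp add: coord_eq_iff prod_eq_iff complex_eq_iff)
  qed
  fix x assume x: "x \<in> W"
  show "x \<in> open_cylinder \<longleftrightarrow> snd (?f x) < 0"
    using T[OF x] by simp
  show "x \<in> unknot n - open_cylinder \<longleftrightarrow> fst (?f x) = 0" if "snd (?f x) \<ge> 0"
    using T[OF x] F[OF x] that by (auto simp: unknot_def complex_eq_iff)
qed

lemma unknot_charts:
  assumes p: "p \<in> unknot n - open_cylinder"
  shows "chart_at (unknot n - open_cylinder) p"
proof -
  let ?u = "\<lambda>x :: space3. coord n (Re (fst x))"
  let ?L = "real (last_strand n)"
  define u h where "u = ?u p" and "h = snd p"
  have on: "on_curve n u h" and im: "Im (fst p) = 0"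
    using p by (auto simp: unknot_def u_def h_def)
  have u: "0 \<le> u" "u \<le> ?L"
    using on by (auto simp: on_curve_def)
  have sin0: "sin (pi * u) = 0" if "u = 0 \<or> u = ?L"
    using that by auto
  have oc: "x \<in> open_cylinder \<longleftrightarrow> norm (fst x) < 1 \<and> 0 < snd x \<and> snd x < 1" for x :: space3
    by (auto simp: mem_Times_iff)
  \<comment> \<open>Arcs above, sine arcs below, V-shaped arc, segments. In the first three cases
    the neighbourhood misses the cylinder and \<open>T\<close> is just a positive
    coordinate.\<close>
  consider "h > 1" | "h < 0" "sin (pi * u) = h" | "h < 0" "h = - 2 * min u (?L - u)" "sin (pi * u) \<noteq> h"
    | "0 \<le> h" "h \<le> 1"
    using on squash_neg[of h] by (fastforce simp: on_curve_def)
  then show ?thesis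
  proof cases
    case 1
    then have "sin (pi * u) = h - 1"
      using on u squash_gt[of h] by (auto simp: on_curve_def min_def)
    then have "0 < u" "u < ?L"
      using u sin0 1 by (auto simp: less_le)
    show ?thesis
    proof (rule chart_at_unknot[where F = "\<lambda>u h. h - 1 - sin (pi * u)" and T = "\<lambda>u h. u + 1"
          and W = "{x. snd x > 1 \<and> 0 < ?u x \<and> ?u x < ?L}"])
      show "open {x. snd x > 1 \<and> 0 < ?u x \<and> ?u x < ?L}"
        by (intro open_Collect_conj open_Collect_less continuous_intros)
      show "on_curve n (?u x) (snd x) \<longleftrightarrow> snd x - 1 - sin (pi * ?u x) = 0"
        if "x \<in> {x. snd x > 1 \<and> 0 < ?u x \<and> ?u x < ?L}" for x
        using that by (auto simp: on_curve_def squash_gt min_def)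
    qed (use 1 \<open>0 < u\<close> \<open>u < ?L\<close> in \<open>auto simp: oc u_def h_def intro!: continuous_intros\<close>)
  next
    case 2
    \<comment> \<open>A negative sine forces distance more than 1 from both ends. The V-shaped arc,
      of slope 2, is below -2 there and misses the sine arc.\<close>
    have "\<not> u \<le> 1" "\<not> ?L - u \<le> 1"
      using sin_pi_nonneg[of u] sin_pi_nonneg[of "?L - u"] u 2 by (auto simp: sin_pi_reflect)
    moreover have "h \<ge> -1" using 2 sin_ge_minus_one by metis
    ultimately have "h \<noteq> - 2 * min u (?L - u)" by (auto simp: min_def)
    have ul: "0 < u" "u < ?L" using \<open>\<not> u \<le> 1\<close> \<open>\<not> ?L - u \<le> 1\<close> by auto
    let ?W = "{x. snd x < 0 \<and> 0 < ?u x \<and> ?u x < ?L \<and> snd x \<noteq> - 2 * min (?u x) (?L - ?u x)}"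
    show ?thesis
    proof (rule chart_at_unknot[where F = "\<lambda>u h. h - sin (pi * u)" and T = "\<lambda>u h. u + 1" and W = ?W])
      show "open ?W"
        by (intro open_Collect_conj open_Collect_less open_Collect_neq continuous_intros)
      show "on_curve n (?u x) (snd x) \<longleftrightarrow> snd x - sin (pi * ?u x) = 0" if "x \<in> ?W" for x
        using that by (auto simp: on_curve_def squash_neg)
    qed (use 2 ul \<open>h \<noteq> _\<close> in \<open>auto simp: oc u_def h_def intro!: continuous_intros\<close>)
  next
    case 3
    then have ul: "0 < u" "u < ?L" by (auto simp: min_def split: if_splits)
    let ?W = "{x. snd x < 0 \<and> 0 < ?u x \<and> ?u x < ?L \<and> sin (pi * ?u x) \<noteq> snd x}"
    \<comment> \<open>The tip of the V needs no separate chart: \<open>F\<close> is continuous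
      there, and u and \<open>F\<close> determine h.\<close>
    show ?thesis
    proof (rule chart_at_unknot[where F = "\<lambda>u h. h + 2 * min u (?L - u)" and T = "\<lambda>u h. u + 1" and W = ?W])
      show "open ?W"
        by (intro open_Collect_conj open_Collect_less open_Collect_neq continuous_intros)
      show "on_curve n (?u x) (snd x) \<longleftrightarrow> snd x + 2 * min (?u x) (?L - ?u x) = 0" if "x \<in> ?W" for x
        using that by (auto simp: on_curve_def squash_neg)
    qed (use 3 ul in \<open>auto simp: oc u_def h_def intro!: continuous_intros\<close>)
  next
    case 4
    obtain j where j: "u = real j" "j \<le> last_strand n"
      using on_curve_mid[OF on 4] .
    obtain c where c: "continuous_on UNIV c"
      "\<And>u h. \<bar>u - real j\<bar> < 1 / 2 \<Longrightarrow> - 1 < h \<Longrightarrow> on_curve n u h \<longleftrightarrow> sin (pi * u) = c h"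
      using on_curve_near_strand[OF j(2)] by blast
    have cF: "continuous_on UNIV (\<lambda>x. sin (pi * fst x) - c (snd x))"
      by (intro continuous_intros continuous_on_compose2[OF c(1)]) auto
    \<comment> \<open>An injective \<open>T\<close> recovers the height, and then the local equation
      recovers u. Only \<open>T\<close> depends on how the strand meets the cylinder.\<close>
    have chart: "chart_at (unknot n - open_cylinder) p"
      if "open V" "p \<in> V" "continuous_on UNIV T" "inj T" 
        and "\<And>x. x \<in> V \<Longrightarrow> \<bar>?u x - real j\<bar> < 1 / 2 \<Longrightarrow> x \<in> open_cylinder \<longleftrightarrow> T (snd x) < 0"
      for V and T :: "real \<Rightarrow> real"
    proof (rule chart_at_unknot[where F = "\<lambda>u h. sin (pi * u) - c h" and T = "\<lambda>u h. T h"
          and W = "V \<inter> {x. \<bar>?u x - real j\<bar> < 1 / 2 \<and> - 1 < snd x}"])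
      show "open (V \<inter> {x. \<bar>?u x - real j\<bar> < 1 / 2 \<and> - 1 < snd x})"
        using that(1) by (intro open_Int open_Collect_conj open_Collect_less continuous_intros) auto
      show "p \<in> V \<inter> {x. \<bar>?u x - real j\<bar> < 1 / 2 \<and> - 1 < snd x}"
        using that(2) j(1) 4 by (auto simp: u_def h_def)
      show "continuous_on UNIV (\<lambda>x :: real \<times> real. T (snd x))"
        by (rule continuous_on_compose2[OF that(3)]) (auto intro: continuous_intros)
      show "?u x = ?u y \<and> snd x = snd y"
        if "x \<in> V \<inter> {x. \<bar>?u x - real j\<bar> < 1 / 2 \<and> - 1 < snd x}"
          "y \<in> V \<inter> {x. \<bar>?u x - real j\<bar> < 1 / 2 \<and> - 1 < snd x}"
          "sin (pi * ?u x) - c (snd x) = sin (pi * ?u y) - c (snd y)" "T (snd x) = T (snd y)" for x y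
      proof -
        have "snd x = snd y" using \<open>inj T\<close> that(4) by (simp add: inj_eq)
        then show ?thesis using that sin_pi_inj[of "?u x" j "?u y"] by simp
      qed
    qed (use that c(2) cF in auto)
    show ?thesis
    proof (cases "j < n")
      case False
      then have out: "norm (fst x) > 1" if "\<bar>?u x - real j\<bar> < 1 / 2" for x :: space3
      proof -
        have "\<not> ?u x \<le> real n - 1 / 2" using that False by (auto simp: abs_less_iff)
        then have "Re (fst x) > 1" by (simp add: coord_le_iff)
        then show ?thesis using complex_Re_le_cmod[of "fst x"] by linarith
      qed
      show ?thesis
      proof (rule chart[where V = "{x. - 1 < snd x}" and T = "\<lambda>h. h + 1"])
        show "open {x :: space3. - 1 < snd x}"
          by (intro open_Collect_less continuous_intros)
        show "x \<in> open_cylinder \<longleftrightarrow> snd x + 1 < 0"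
          if "x \<in> {x. - 1 < snd x}" "\<bar>?u x - real j\<bar> < 1 / 2" for x
          using that out[OF that(2)] unfolding oc by auto
      qed (use 4 in \<open>auto simp: h_def inj_def intro!: continuous_intros\<close>)
    next
      case True
      have "coord n (Re (fst p)) = coord n (Re (braid_point n j))"
        using j coord_braid_point[OF True] by (simp add: u_def)
      then have "fst p = braid_point n j"
        using im by (simp add: coord_eq_iff complex_eq_iff braid_point_eq)
      then have norm: "norm (fst p) < 1"
        using norm_braid_point_less[OF True] by simp
      \<comment> \<open>Points of the strand strictly between these heights lie in the open cylinder
        and have been removed.\<close>
      then consider "h = 1" | "h = 0"
        using p 4 unfolding h_def by (fastforce simp: oc)
      then show ?thesis
      proof cases
        case 1
        show ?thesis
        proof (rule chart[where V = "{x. norm (fst x) < 1 \<and> 1 / 2 < snd x}" and T = "\<lambda>h. h - 1"])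
          show "open {x :: space3. norm (fst x) < 1 \<and> 1 / 2 < snd x}"
            by (intro open_Collect_conj open_Collect_less continuous_intros)
        qed (use 1 norm in \<open>auto simp: oc h_def inj_def intro!: continuous_intros\<close>)
      next
        case 2
        show ?thesis
        proof (rule chart[where V = "{x. norm (fst x) < 1 \<and> snd x < 1 / 2}" and T = "\<lambda>h. - h"])
          show "open {x :: space3. norm (fst x) < 1 \<and> snd x < 1 / 2}"
            by (intro open_Collect_conj open_Collect_less continuous_intros)
        qed (use 2 norm in \<open>auto simp: oc h_def inj_def intro!: continuous_intros\<close>)
      qed
    qed
  qed
qed

text \<open>At heights from 0 to 1 the curve lies over integers, and the edge of the disc at n - 1/2
  keeps exactly those below \<open>n\<close>.\<close>

lemma unknot_Int_cylinder: "unknot n \<inter> cylinder = trivial_braid n"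
proof
  show "unknot n \<inter> cylinder \<subseteq> trivial_braid n"
  proof
    fix x :: space3 assume "x \<in> unknot n \<inter> cylinder"
    then have x: "Im (fst x) = 0" "on_curve n (coord n (Re (fst x))) (snd x)"
      "norm (fst x) \<le> 1" "0 \<le> snd x" "snd x \<le> 1"
      by (auto simp: unknot_def cylinder_def mem_Times_iff)
    obtain j where j: "coord n (Re (fst x)) = real j"
      using on_curve_mid[OF x(2,4,5)] by blast
    have "Re (fst x) \<le> 1"
      using x(3) complex_Re_le_cmod order_trans by blast
    then have "real j \<le> real n - 1 / 2"
      using coord_le_iff j by metis
    then have "j < n" by linarith
    then have "coord n (Re (fst x)) = coord n (Re (braid_point n j))"
      using j coord_braid_point by simp
    then have "fst x = braid_point n j"
      using x(1) by (simp add: coord_eq_iff complex_eq_iff braid_point_eq)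
    then have "x = (braid_point n j, snd x)"
      by (simp add: prod_eq_iff)
    then show "x \<in> trivial_braid n"
      unfolding trivial_braid_def strands_def using \<open>j < n\<close> x(4,5) by auto
  qed
  show "trivial_braid n \<subseteq> unknot n \<inter> cylinder"
  proof
    fix x assume "x \<in> trivial_braid n"
    then obtain i t where i: "i < n" "0 \<le> t" "t \<le> 1" "x = (braid_point n i, t)"
      by (auto simp: trivial_braid_def strands_def)
    have "on_curve n (real i) t"
      using i le_last_strand[of n] by (simp add: on_curve_def squash_mid)
    then show "x \<in> unknot n \<inter> cylinder"
      using i norm_braid_point_less[OF i(1)] coord_braid_point[OF i(1)]
      by (auto simp: unknot_def cylinder_def braid_point_eq)
  qed
qed

section \<open>Connectedness and compactness of the curve\<close>

text \<open>Collapsing the inserted segments is a closed map onto the sine graph with intervals as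
  fibres, and such a map pulls connected sets back to connected sets.\<close>

lemma connected_sine_part: 
  "connected {(u, h). 0 \<le> u \<and> u \<le> real m \<and> sin (pi * u) = squash h}"
proof -
  define f where "f = (\<lambda>(u :: real, h). (u, squash h))"
  \<comment> \<open>The box contains all solutions, as \<open>\<bar>squash h\<bar> \<le> 1\<close>
    forces -1 \<le> h \<le> 2; its compactness makes \<open>f\<close> closed.\<close>
  define S where "S = {0..real m} \<times> {-2..3::real}"
  define G where "G = (\<lambda>u. (u, sin (pi * u))) ` {0..real m}"
  have f: "continuous_on S f"
    unfolding f_def case_prod_unfold by (intro continuous_intros)
  have "connected (S \<inter> f -` G)"
  proof (rule connected_closed_monotone_preimage[OF f refl])
    show "closedin (top_of_set (f ` S)) (f ` C)" if "closedin (top_of_set S) C" for C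
      by (rule Abstract_Topology_2.continuous_imp_closed_map[OF that f refl]) (simp add: S_def compact_Times)
    show "connected G"
      unfolding G_def by (intro connected_continuous_image continuous_intros) simp
    show "G \<subseteq> f ` S"
    proof
      fix y assume "y \<in> G"
      then obtain u where u: "0 \<le> u" "u \<le> real m" "y = (u, sin (pi * u))"
        by (auto simp: G_def)
      define v where "v = sin (pi * u)"
      have v: "- 1 \<le> v" "v \<le> 1" by (auto simp: v_def)
      have "y = f (u, if v \<ge> 0 then v + 1 else v)"
        using u by (simp add: f_def squash_def v_def)
      moreover have "(u, if v \<ge> 0 then v + 1 else v) \<in> S"
        using u v by (auto simp: S_def)
      ultimately show "y \<in> f ` S" by blast
    qed
    fix y assume "y \<in> f ` S"
    then have "fst y \<in> {0..real m}"
      by (auto simp: S_def f_def)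
    then have "S \<inter> f -` {y} = {fst y} \<times> {h \<in> {-2..3}. squash h = snd y}"
      by (auto simp: S_def f_def prod_eq_iff)
    moreover have "connected {h \<in> {-2..3}. squash h = snd y}"
      unfolding is_interval_connected_1[symmetric] is_interval_1
    proof (intro ballI allI impI)
      fix a b x assume "a \<in> {h \<in> {-2..3}. squash h = snd y}" "b \<in> {h \<in> {-2..3}. squash h = snd y}"
        "a \<le> x \<and> x \<le> b"
      moreover from this have "squash a \<le> squash x" "squash x \<le> squash b"
        by (auto simp: squash_def)
      ultimately show "x \<in> {h \<in> {-2..3}. squash h = snd y}"
        by auto
    qed
    ultimately show "connected (S \<inter> f -` {y})"
      by (simp add: connected_Times)
  qed
  moreover have "S \<inter> f -` G = {(u, h). 0 \<le> u \<and> u \<le> real m \<and> sin (pi * u) = squash h}"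
  proof -
    have "h \<in> {-2..3}" if "sin (pi * u) = squash h" for u h
      using sin_ge_minus_one[of "pi * u"] sin_le_one[of "pi * u"] unfolding that squash_def by auto
    then show ?thesis
      by (fastforce simp: S_def f_def G_def)
  qed
  ultimately show ?thesis by simp
qed

lemma connected_curve: "connected {(u, h). on_curve n u h}"
proof -
  let ?L = "real (last_strand n)"
  let ?A = "{(u, h). 0 \<le> u \<and> u \<le> ?L \<and> sin (pi * u) = squash h}"
  let ?B = "(\<lambda>u. (u, - 2 * min u (?L - u))) ` {0..?L}"
  have "connected ?B"
    by (intro connected_continuous_image continuous_intros) simp
  moreover have "(0, 0) \<in> ?A" "(0, 0) \<in> ?B"
    by (auto simp: squash_def image_iff intro!: bexI[of _ 0])
  ultimately have "connected (?A \<union> ?B)"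
    using connected_sine_part by (intro connected_Un) blast+
  moreover have "?A \<union> ?B = {(u, h). on_curve n u h}"
    by (auto simp: on_curve_def)
  ultimately show ?thesis by simp
qed

lemma on_curve_bounded:
  assumes "on_curve n u h" shows "\<bar>h\<bar> \<le> 2 * real (last_strand n) + 2"
proof (cases "sin (pi * u) = squash h")
  case True
  then have "\<bar>squash h\<bar> \<le> 1" by (metis abs_sin_le_one)
  then have "\<bar>h\<bar> \<le> 2" by (auto simp: squash_def max_def min_def split: if_splits)
  then show ?thesis by linarith
next
  case False
  then show ?thesis using assms by (auto simp: on_curve_def min_def split: if_splits)
qed

lemma unknot_eq_image:
  "unknot n = (\<lambda>(u, h). (complex_of_real (coord_inv n u), h)) ` {(u, h). on_curve n u h}"
proof
  show "unknot n \<subseteq> (\<lambda>(u, h). (complex_of_real (coord_inv n u), h)) ` {(u, h). on_curve n u h}"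
  proof
    fix x assume x: "x \<in> unknot n"
    then show "x \<in> (\<lambda>(u, h). (complex_of_real (coord_inv n u), h)) ` {(u, h). on_curve n u h}"
      by (intro image_eqI[of _ _ "(coord n (Re (fst x)), snd x)"])
        (auto simp: unknot_def coord_inv_coord prod_eq_iff complex_eq_iff)
  qed
qed (auto simp: unknot_def coord_coord_inv)

lemma continuous_on_unknot_param:
  "continuous_on S (\<lambda>(u, h). (complex_of_real (coord_inv n u), h :: real))"
  unfolding case_prod_unfold coord_inv_def by (intro continuous_intros) auto

lemma compact_unknot: "compact (unknot n)"
proof -
  let ?L = "real (last_strand n)"
  have "closed {x. on_curve n (fst x) (snd x)}"
    unfolding on_curve_def
    by (intro closed_Collect_conj closed_Collect_disj closed_Collect_le closed_Collect_eq continuous_intros)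
  moreover have "{x. on_curve n (fst x) (snd x)} \<subseteq> {0..?L} \<times> {- (2 * ?L + 2)..2 * ?L + 2}"
    using on_curve_bounded by (fastforce simp: on_curve_def abs_le_iff)
  moreover have "compact ({0..?L} \<times> {- (2 * ?L + 2)..2 * ?L + 2})"
    by (intro compact_Times compact_Icc)
  ultimately have "compact {x. on_curve n (fst x) (snd x)}"
    using compact_Int_closed Int_absorb1 by metis
  moreover have "{x. on_curve n (fst x) (snd x)} = {(u, h). on_curve n u h}"
    by auto
  ultimately show ?thesis
    unfolding unknot_eq_image
    by (metis compact_continuous_image continuous_on_unknot_param)
qed

lemma connected_unknot: "connected (unknot n)"
  unfolding unknot_eq_image
  by (intro connected_continuous_image continuous_on_unknot_param connected_curve)

lemma unknot_nonempty: "unknot n \<noteq> {}"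
proof -
  have "on_curve n 0 0" by (simp add: on_curve_def squash_def)
  then show ?thesis unfolding unknot_eq_image by blast
qed

section \<open>The diagram and its reduced bracket\<close>

text \<open>The projection forgets only the imaginary part, which is 0 on the curve, so there are no
  crossings.\<close>

lemma diagram_of_unknot: "diagram_of (unknot n) (proj ` unknot n, [])"
  by (auto simp: diagram_of_def inj_on_def unknot_def proj_def complex_eq_iff prod_eq_iff)

lemma delta_nonzero: "delta \<noteq> 0"
proof
  assume "delta = 0"
  then have "Poly_Mapping.lookup delta 2 = 0" by simp
  then show False by (simp add: delta_def A_pow_def lookup_minus lookup_single)
qed

text \<open>Without crossings the bracket is a power of \<open>delta\<close> whose exponent counts
  components, here one; cancelling \<open>delta\<close> leaves 1.\<close>

lemma reduced_bracket_unknot: "reduced_bracket (proj ` unknot n, []) = 1"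
proof -
  have "continuous_on (unknot n) proj"
    unfolding proj_def Complex_eq by (intro continuous_intros)
  then have "connected (proj ` unknot n)"
    using connected_unknot connected_continuous_image by blast
  then have "components (proj ` unknot n) = {proj ` unknot n}"
    using unknot_nonempty by (simp add: components_eq_sing_iff)
  then have "kauffman_bracket (proj ` unknot n, []) = delta"
    by (simp add: kauffman_bracket_def)
  then show ?thesis
    unfolding reduced_bracket_def using delta_nonzero by (auto intro!: the_equality)
qed

section \<open>Transport of the closure to the given tangle\<close>

theorem proposition1p5:
  fixes n :: nat and B T :: "space4 set"
  assumes "tangle n B T" and "braid_tangle n B T"
  shows "kauffman_ideal B T = UNIV"
proof -
  obtain K H where K: "geometric_braid n K" and H: "ambient_isotopy H"
    and B: "B = H 1 ` stereo ` cylinder" and T: "T = H 1 ` stereo ` K"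
    using assms(2) by (auto simp: braid_tangle_def)
  obtain G where G: "ambient_isotopy G" "G 1 ` stereo ` cylinder = stereo ` cylinder"
    "G 1 ` stereo ` trivial_braid n = stereo ` K"
    using geometric_braid_isotopic_trivial[OF K] .
  have iso: "ambient_isotopy (\<lambda>t. H t \<circ> G t)"
    by (rule ambient_isotopy_comp[OF H G(1)])
  define \<Phi> where "\<Phi> = H 1 \<circ> G 1"
  obtain g where \<Phi>: "homeomorphism S3 S3 \<Phi> g"
    using ambient_isotopy_homeomorphism[OF iso] unfolding \<Phi>_def by blast
  have B': "B = \<Phi> ` stereo ` cylinder" and T': "T = \<Phi> ` stereo ` trivial_braid n"
    unfolding B T \<Phi>_def by (simp_all only: image_comp[symmetric] G)
  have sub: "stereo ` X \<subseteq> S3" for X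
    using stereo_in_S3 by blast
  have inj: "inj (\<lambda>x. \<Phi> (stereo x))"
    using homeomorphism_apply1[OF \<Phi>] stereo_in_S3 stereo_inv_stereo by (metis injI)
  have Int: "\<Phi> ` stereo ` X \<inter> \<Phi> ` stereo ` Y = \<Phi> ` stereo ` (X \<inter> Y)" for X Y
    using image_Int[OF inj, of X Y] by (simp only: image_image)
  define C where "C = unknot n - open_cylinder"
  have "compact C"
    unfolding C_def by (intro compact_diff compact_unknot open_Times) auto
  then have "properly_embedded_1_manifold (S3 - stereo ` open_cylinder) (stereo ` C)"
    unfolding C_def by (rule properly_embedded_of_charts) (use unknot_charts in auto)
  then have "properly_embedded_1_manifold (exterior_S3 B) (\<Phi> ` stereo ` C)"
    unfolding B' exterior_S3_image[OF \<Phi> sub] exterior_S3_cylinder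
    by (rule properly_embedded_image[OF \<Phi> Diff_subset])
  moreover have "\<Phi> ` stereo ` C \<inter> boundary_S3 B = T \<inter> boundary_S3 B"
  proof -
    \<comment> \<open>Both sides are the points of the curve on the boundary of the
      cylinder.\<close>
    have "C \<inter> (cylinder - open_cylinder) = trivial_braid n \<inter> (cylinder - open_cylinder)"
      unfolding C_def unknot_Int_cylinder[symmetric] by blast
    then show ?thesis
      unfolding B' T' boundary_S3_image[OF \<Phi> sub] boundary_S3_cylinder Int by simp
  qed
  moreover have "\<Phi> ` stereo ` unknot n = T \<union> \<Phi> ` stereo ` C"
  proof -
    have "open_cylinder \<subseteq> cylinder"
      using interior_subset[of cylinder] unfolding interior_cylinder .
    then have "unknot n = trivial_braid n \<union> C"
      unfolding C_def unknot_Int_cylinder[symmetric] by blast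
    then show ?thesis
      unfolding T' by (metis image_Un)
  qed
  ultimately have "tangle_closure B T (\<Phi> ` stereo ` unknot n)"
    unfolding tangle_closure_def by blast
  \<comment> \<open>The isotopy ending in \<open>\<Phi>\<close> starts at the identity and moves the
    planar curve to the closure, so the crossingless diagram represents the closure.\<close>
  moreover have "link_diagram (\<Phi> ` stereo ` unknot n) (proj ` unknot n, [])"
    unfolding link_diagram_def ambient_isotopic_def \<Phi>_def
    using diagram_of_unknot iso by blast
  moreover have "\<Phi> ` stereo ` unknot n \<noteq> {}"
    using unknot_nonempty by simp
  ultimately have "1 \<in> {reduced_bracket D | D L. tangle_closure B T L \<and> L \<noteq> {} \<and> link_diagram L D}"
    using reduced_bracket_unknot[of n] by (metis (mono_tags, lifting) mem_Collect_eq)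
  then have "1 \<in> kauffman_ideal B T"
    unfolding kauffman_ideal_def by (rule module.span_base[OF module_laurent])
  then have "c * 1 \<in> kauffman_ideal B T" for c
    unfolding kauffman_ideal_def by (rule module.span_scale[OF module_laurent])
  then show ?thesis by auto
qed

end
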